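(* Let $G$ be a bridgeless cubic graph. If $m_G^* \geq 5\mu_2(G) - 3$, then $G$ has a nowhere-zero 5-flow.
   Context: A cubic graph is a graph all of whose vertices have degree 3 (graphs are finite). A 1-factor of $G$ is a perfect matching, regarded as a set of edges; a 2-factor is a spanning 2-regular subgraph, i.e. a disjoint union of circuits covering all vertices. For a bridgeless cubic graph $G$ (which has 1-factors and 2-factors by Petersen's theorem): - $\mu_2(G) = \min\{|M_1 \cap M_2| : M_1 \text{ and } M_2 \text{ are 1-factors of } G\}$. - The oddness $\omega(G)$ is the minimum number of odd circuits in a 2-factor of $G$. A minimum 2-factor of $G$ is a 2-factor with precisely $\omega(G)$ odd circuits. - If $\omega(G) \geq 2$ and $\mathcal{F}$ is a minimum 2-factor of $G$, then $m_G(\mathcal{F})$ is the maximum number $k$ such that $G$ has no edge cut $E$ with fewer than $k$ edges such that two components of $G-E$ contain odd circuits of $\mathcal{F}$. (The oddness of a cubic graph is even, so $\omega(G)>0$ means $\omega(G)\ge 2$.) - $m_G^* = \infty$ if $\omega(G)=0$, and $m_G^* = \max\{m_G(\mathcal{F}) : \mathcal{F} \text{ is a minimum 2-factor of } G\}$ if $\omega(G)>0$. A nowhere-zero $k$-flow on $G$ is an assignment of a direction and a value from $\{1,\dots,k-1\}$ to each edge of $G$ such that Kirchhoff's law holds at every vertex (the sum of the values on incoming edges equals the sum of the values on outgoing edges). *)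

theory Defs
  imports Complex_Main "HOL-Library.Extended_Real"
begin

text \<open>
  Graphs are undirected and may have parallel edges and loops: edges are abstract objects, and
  \<open>ends\<close> maps an edge to the set of its end-vertices, which is a singleton for a loop.
\<close>

record ('v, 'e) graph =
  verts :: "'v set"
  edges :: "'e set"
  ends :: "'e \<Rightarrow> 'v set"

definition finite_graph :: "('v, 'e) graph \<Rightarrow> bool" where
  "finite_graph G \<longleftrightarrow> finite (verts G) \<and> finite (edges G) \<and>
     (\<forall>e \<in> edges G. ends G e \<subseteq> verts G \<and> card (ends G e) \<in> {1, 2})"

text \<open>A loop contributes 2 to the degree of its vertex.\<close>

definition degree :: "('v, 'e) graph \<Rightarrow> 'v \<Rightarrow> nat" where
  "degree G v = card {e \<in> edges G. v \<in> ends G e} + card {e \<in> edges G. ends G e = {v}}"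

definition regular :: "nat \<Rightarrow> ('v, 'e) graph \<Rightarrow> bool" where
  "regular k G \<longleftrightarrow> (\<forall>v \<in> verts G. degree G v = k)"

abbreviation cubic :: "('v, 'e) graph \<Rightarrow> bool" where
  "cubic \<equiv> regular 3"

definition subgraph :: "('v, 'e) graph \<Rightarrow> ('v, 'e) graph \<Rightarrow> bool" where
  "subgraph H G \<longleftrightarrow> verts H \<subseteq> verts G \<and> edges H \<subseteq> edges G \<and> (\<forall>e \<in> edges H. ends H e = ends G e)"

definition spanning_subgraph :: "('v, 'e) graph \<Rightarrow> 'e set \<Rightarrow> ('v, 'e) graph" where
  "spanning_subgraph G F = G\<lparr>edges := F\<rparr>"

definition delete_edges :: "('v, 'e) graph \<Rightarrow> 'e set \<Rightarrow> ('v, 'e) graph" where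
  "delete_edges G X = spanning_subgraph G (edges G - X)"

definition induced_subgraph :: "('v, 'e) graph \<Rightarrow> 'v set \<Rightarrow> ('v, 'e) graph" where
  "induced_subgraph G K = G\<lparr>verts := K, edges := {e \<in> edges G. ends G e \<subseteq> K}\<rparr>"

definition adjacency :: "('v, 'e) graph \<Rightarrow> ('v \<times> 'v) set" where
  "adjacency G = {(u, v). \<exists>e \<in> edges G. ends G e = {u, v}}"

definition connectedness :: "('v, 'e) graph \<Rightarrow> ('v \<times> 'v) set" where
  "connectedness G = {(u, v). u \<in> verts G \<and> v \<in> verts G \<and> (u, v) \<in> (adjacency G)\<^sup>*}"

text \<open>Components are subgraphs, not just vertex sets.\<close>

definition components :: "('v, 'e) graph \<Rightarrow> ('v, 'e) graph set" where
  "components G = induced_subgraph G ` (verts G // connectedness G)"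

definition bridge :: "('v, 'e) graph \<Rightarrow> 'e \<Rightarrow> bool" where
  "bridge G e \<longleftrightarrow> e \<in> edges G \<and> card (components (delete_edges G {e})) > card (components G)"

definition bridgeless :: "('v, 'e) graph \<Rightarrow> bool" where
  "bridgeless G \<longleftrightarrow> (\<forall>e \<in> edges G. \<not> bridge G e)"

definition edge_cut :: "('v, 'e) graph \<Rightarrow> 'e set \<Rightarrow> bool" where
  "edge_cut G X \<longleftrightarrow> (\<exists>S. S \<noteq> {} \<and> S \<subset> verts G \<and>
     X = {e \<in> edges G. ends G e \<inter> S \<noteq> {} \<and> ends G e \<inter> (verts G - S) \<noteq> {}})"

text \<open>
  A spanning subgraph is determined by its edge set, so factors are represented by edge sets.
\<close>

definition is_factor :: "nat \<Rightarrow> ('v, 'e) graph \<Rightarrow> 'e set \<Rightarrow> bool" where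
  "is_factor k G F \<longleftrightarrow> F \<subseteq> edges G \<and> regular k (spanning_subgraph G F)"

definition mu2 :: "('v, 'e) graph \<Rightarrow> nat" where
  "mu2 G = Min {card (M1 \<inter> M2) | M1 M2. is_factor 1 G M1 \<and> is_factor 1 G M2}"

text \<open>The circuits of a 2-factor are the components of the corresponding 2-regular spanning subgraph.\<close>

definition odd_circuits :: "('v, 'e) graph \<Rightarrow> 'e set \<Rightarrow> ('v, 'e) graph set" where
  "odd_circuits G F = {C \<in> components (spanning_subgraph G F). odd (card (edges C))}"

definition oddness :: "('v, 'e) graph \<Rightarrow> nat" where
  "oddness G = Min {card (odd_circuits G F) | F. is_factor 2 G F}"

definition min_two_factor :: "('v, 'e) graph \<Rightarrow> 'e set \<Rightarrow> bool" where
  "min_two_factor G F \<longleftrightarrow> is_factor 2 G F \<and> card (odd_circuits G F) = oddness G"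

definition separates_odd_circuits :: "('v, 'e) graph \<Rightarrow> 'e set \<Rightarrow> 'e set \<Rightarrow> bool" where
  "separates_odd_circuits G F X \<longleftrightarrow>
     (\<exists>K1 \<in> components (delete_edges G X). \<exists>K2 \<in> components (delete_edges G X). K1 \<noteq> K2 \<and>
        (\<exists>C \<in> odd_circuits G F. subgraph C K1) \<and> (\<exists>C \<in> odd_circuits G F. subgraph C K2))"

text \<open>Only meaningful if \<open>F\<close> has at least two odd circuits; otherwise the set is unbounded.\<close>

definition m_factor :: "('v, 'e) graph \<Rightarrow> 'e set \<Rightarrow> nat" where
  "m_factor G F = Max {k. \<not> (\<exists>X. edge_cut G X \<and> card X < k \<and> separates_odd_circuits G F X)}"

definition m_star :: "('v, 'e) graph \<Rightarrow> enat" where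
  "m_star G = (if oddness G = 0 then \<infinity> else enat (Max {m_factor G F | F. min_two_factor G F}))"

text \<open>The edge \<open>e\<close> is directed from \<open>tl e\<close> to \<open>hd e\<close>.\<close>

definition has_nowhere_zero_flow :: "nat \<Rightarrow> ('v, 'e) graph \<Rightarrow> bool" where
  "has_nowhere_zero_flow k G \<longleftrightarrow> (\<exists>(tl :: 'e \<Rightarrow> 'v) (hd :: 'e \<Rightarrow> 'v) (f :: 'e \<Rightarrow> nat).
     (\<forall>e \<in> edges G. ends G e = {tl e, hd e} \<and> f e \<in> {1..k - 1}) \<and>
     (\<forall>v \<in> verts G. (\<Sum>e | e \<in> edges G \<and> hd e = v. f e) = (\<Sum>e | e \<in> edges G \<and> tl e = v. f e)))"

end

theory Submission
  imports Defs "HOL-Library.Disjoint_Sets"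
begin

text \<open>
  By the theorem of Bondy and Jaeger it suffices to find signs \<open>\<sigma> v = \<plusminus>1\<close> with
  \<open>5 \<bar>\<sigma>(X)\<bar> \<le> 3 d(X)\<close> for every vertex set \<open>X\<close>, where \<open>d(X)\<close> is the number of edges leaving
  \<open>X\<close>. Let \<open>F\<close> be a minimum 2-factor attaining \<open>m\<^sub>G\<^sup>*\<close>, with complement \<open>M\<close>, and let \<open>N \<subseteq> F\<close> be a matching
  that misses one vertex of each odd circuit and no other vertex. Choose \<open>\<sigma>\<close> so that the two ends
  of every edge of \<open>M \<union> N\<close> have opposite signs. Edges of \<open>M\<close> inside \<open>X\<close> cancel, so
  \<open>\<bar>\<sigma>(X)\<bar> \<le> d\<^sub>M(X)\<close>. If \<open>X\<close> contains no odd circuit, then cancelling along \<open>N\<close> loses at most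
  \<open>1\<close> on each circuit crossing the boundary, which it does at least twice; hence
  \<open>2 \<bar>\<sigma>(X)\<bar> \<le> 3 d\<^sub>F(X)\<close>, and the two bounds add up. The same holds if the complement of
  \<open>X\<close> contains no odd circuit. Otherwise \<open>d(X) \<ge> 5 \<mu>\<^sub>2 - 3\<close>; the oddness is at most \<open>2 \<mu>\<^sub>2\<close>, so
  the vertices missed by \<open>N\<close> contribute at most \<open>\<mu>\<^sub>2\<close>, and
  \<open>2 \<bar>\<sigma>(X)\<bar> \<le> d(X) + \<mu>\<^sub>2\<close>. Since \<open>\<sigma>(X)\<close> and \<open>d(X)\<close> have the same parity, this suffices.
\<close>

section \<open>The Tutte-Berge formula\<close>

text \<open>Edges are vertex sets here: parallel edges are identified, and \<open>card A = 2\<close>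
  excludes loops. \<open>matching_edges\<close> leads back to graphs. The ground set
  \<open>V\<close> is kept apart from \<open>E\<close>, so that vertices can be deleted while
  \<open>E\<close> stays fixed.\<close>

definition matching :: "'v set set \<Rightarrow> 'v set \<Rightarrow> 'v set set \<Rightarrow> bool" where
  "matching E V M \<longleftrightarrow> M \<subseteq> E \<and> \<Union>M \<subseteq> V \<and> (\<forall>A \<in> M. card A = 2) \<and> disjoint M"

definition max_matching :: "'v set set \<Rightarrow> 'v set \<Rightarrow> 'v set set \<Rightarrow> bool" where
  "max_matching E V M \<longleftrightarrow> matching E V M \<and> (\<forall>N. matching E V N \<longrightarrow> card N \<le> card M)"

lemma matching_finite: "finite V \<Longrightarrow> matching E V M \<Longrightarrow> finite M"
  unfolding matching_def by (meson finite_UnionD finite_subset)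

lemma card_disjoint_pairs:
  assumes "\<forall>A \<in> M. card A = 2" "disjoint M"
  shows "card (\<Union>M) = 2 * card M"
proof -
  have "card (\<Union>M) = sum card M"
    using assms by (intro card_Union_disjoint) (auto simp: card_eq_0_iff intro: card_ge_0_finite)
  then show ?thesis using assms by simp
qed

lemma matching_card: "matching E V M \<Longrightarrow> card (\<Union>M) = 2 * card M"
  unfolding matching_def using card_disjoint_pairs by blast

lemma matching_disjoint:
  "matching E V M \<Longrightarrow> A \<in> M \<Longrightarrow> B \<in> M \<Longrightarrow> A \<noteq> B \<Longrightarrow> A \<inter> B = {}"
  unfolding matching_def by (meson disjointD)

lemma card_uncovered:
  assumes "finite V" "matching E V M"
  shows "card (V - \<Union>M) + 2 * card M = card V"
proof -
  have "\<Union>M \<subseteq> V" using assms(2) by (simp add: matching_def)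
  then show ?thesis
    using assms card_Diff_subset[of "\<Union>M" V] card_mono[of V "\<Union>M"] matching_card[OF assms(2)]
    by (simp add: finite_subset)
qed

text \<open>Edges of \<open>M\<close> that meet \<open>K\<close> lie inside it, so the covered part
  of \<open>K\<close> is a disjoint union of pairs.\<close>

lemma even_card_closed_Int_matching:
  assumes M: "matching E V M" and closed: "\<forall>A \<in> M. A \<inter> K \<noteq> {} \<longrightarrow> A \<subseteq> K"
  shows "even (card (K \<inter> \<Union>M))"
proof -
  have "K \<inter> \<Union>M = \<Union>{A \<in> M. A \<subseteq> K}" using closed by blast
  moreover have "card (\<Union>{A \<in> M. A \<subseteq> K}) = 2 * card {A \<in> M. A \<subseteq> K}"
    using M unfolding matching_def by (intro card_disjoint_pairs) (auto simp: pairwise_def)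
  ultimately show ?thesis by simp
qed

lemma max_matching_exists:
  assumes "finite V" shows "\<exists>M. max_matching E V M"
proof -
  have "\<forall>M. matching E V M \<longrightarrow> card M < Suc (card (Pow V))"
    using assms unfolding matching_def
    by (metis Pow_iff Sup_le_iff card_mono finite_Pow_iff less_Suc_eq_le subsetI)
  moreover have "matching E V {}" by (simp add: matching_def)
  ultimately have "\<exists>M. matching E V M \<and> (\<forall>N. matching E V N \<longrightarrow> card N \<le> card M)"
    by (intro ex_has_greatest_nat) auto
  then show ?thesis by (simp add: max_matching_def)
qed

lemma matching_insert:
  assumes "matching E V M" "A \<in> E" "A \<subseteq> V" "card A = 2" "A \<inter> \<Union>M = {}"
  shows "matching E V (insert A M)"
proof -
  have "\<forall>B \<in> M. disjnt A B \<and> disjnt B A" using assms(5) unfolding disjnt_def by blast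
  then have "disjoint (insert A M)"
    using assms(1) unfolding matching_def by (simp add: pairwise_insert)
  then show ?thesis using assms unfolding matching_def by simp
qed

lemma max_matching_meets_edge:
  assumes "finite V" "max_matching E V M" "A \<in> E" "A \<subseteq> V" "card A = 2"
  shows "A \<inter> \<Union>M \<noteq> {}"
proof
  assume A: "A \<inter> \<Union>M = {}"
  have M: "matching E V M" using assms(2) by (simp add: max_matching_def)
  have "matching E V (insert A M)" by (rule matching_insert[OF M assms(3,4,5) A])
  moreover have "A \<notin> M" 
    using A assms(5) by (metis Int_absorb2 Union_upper card.empty zero_neq_numeral)
  ultimately show False using assms(1,2) matching_finite[OF _ M]
    by (metis card_insert_disjoint lessI max_matching_def not_less)
qed

lemma matching_subset: "matching E V M \<Longrightarrow> N \<subseteq> M \<Longrightarrow> matching E V N"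
  unfolding matching_def by (meson Union_mono pairwise_subset subset_iff subset_trans)

text \<open>
  Transitivity here is Gallai's lemma: if \<open>M\<close> misses \<open>u\<close> and \<open>v\<close>, take a maximum matching
  \<open>N\<close> missing \<open>t\<close> that agrees with \<open>M\<close> as much as possible; exchanging one edge of \<open>N\<close> for one
  of \<open>M\<close> improves the agreement.
\<close>

lemma gallai_transitive:
  assumes fin: "finite V" and miss: "\<exists>N. max_matching E V N \<and> t \<notin> \<Union>N"
    and ut: "\<And>M. max_matching E V M \<Longrightarrow> u \<in> \<Union>M \<or> t \<in> \<Union>M"
    and tv: "\<And>M. max_matching E V M \<Longrightarrow> t \<in> \<Union>M \<or> v \<in> \<Union>M"
    and "u \<noteq> v" and M: "max_matching E V M"
  shows "u \<in> \<Union>M \<or> v \<in> \<Union>M"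
proof (rule ccontr)
  assume "\<not> (u \<in> \<Union>M \<or> v \<in> \<Union>M)"
  then have u: "u \<notin> \<Union>M" and v: "v \<notin> \<Union>M" by auto
  have Mm: "matching E V M" using M by (simp add: max_matching_def)
  have finM: "finite M" using matching_finite fin Mm by blast
  let ?P = "\<lambda>N. max_matching E V N \<and> t \<notin> \<Union>N"
  obtain N where N: "?P N" and best: "\<And>N'. ?P N' \<Longrightarrow> card (M \<inter> N') \<le> card (M \<inter> N)"
  proof -
    have "\<forall>N. ?P N \<longrightarrow> card (M \<inter> N) < Suc (card M)"
      by (simp add: card_mono finM less_Suc_eq_le)
    then have "\<exists>N. ?P N \<and> (\<forall>N'. ?P N' \<longrightarrow> card (M \<inter> N') \<le> card (M \<inter> N))"
      using miss ex_has_greatest_nat[of ?P _ "\<lambda>N. card (M \<inter> N)"] by blast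
    then show ?thesis using that by blast
  qed
  have Nm: "matching E V N" and Nmax: "max_matching E V N" and tN: "t \<notin> \<Union>N"
    using N by (auto simp: max_matching_def)
  have finN: "finite N" using matching_finite fin Nm by blast
  have uN: "u \<in> \<Union>N" and vN: "v \<in> \<Union>N" using ut[OF Nmax] tv[OF Nmax] tN by auto
  have cards: "card M = card N" using M N by (meson le_antisym max_matching_def)
  have finU: "finite (\<Union>M)" "finite (\<Union>N)"
    using Mm Nm fin finite_subset unfolding matching_def by blast+
  have "card (\<Union>M) = card (\<Union>N)" using cards matching_card Mm Nm by metis
  then have eq: "card (\<Union>M - \<Union>N) = card (\<Union>N - \<Union>M)"
    using finU by (metis card_Diff_subset_Int finite_Int inf_commute)
  \<comment> \<open>\<open>N\<close> covers both \<open>u\<close> and \<open>v\<close>, which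
    \<open>M\<close> misses. Since the two matchings cover equally many vertices, \<open>M\<close>
    covers at least two vertices missed by \<open>N\<close>, hence one other than
    \<open>t\<close>.\<close>
  have "card {u, v} \<le> card (\<Union>N - \<Union>M)"
    using u v uN vN finU by (intro card_mono) auto
  then have two: "2 \<le> card (\<Union>M - \<Union>N)" using \<open>u \<noteq> v\<close> eq by simp
  have "\<not> \<Union>M - \<Union>N \<subseteq> {t}"
    using two card_mono[of "{t}" "\<Union>M - \<Union>N"] by auto
  then obtain x where x: "x \<in> \<Union>M" "x \<notin> \<Union>N" "x \<noteq> t" by blast
  then obtain A where A: "A \<in> M" "x \<in> A" by blast
  have A2: "card A = 2" "A \<in> E" "A \<subseteq> V" using A Mm unfolding matching_def by auto
  obtain y where y: "A = {x, y}" "x \<noteq> y"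
    using A2(1) A(2) by (metis card_2_iff doubleton_eq_iff insertE singletonD)
  have "y \<in> \<Union>N"
    using max_matching_meets_edge[OF fin Nmax A2(2,3,1)] y x(2) by auto
  then obtain B where B: "B \<in> N" "y \<in> B" by blast
  have AB: "A \<noteq> B" and AN: "A \<notin> N" using B A x by auto
  have "B \<notin> M" using matching_disjoint[OF Mm A(1) _ AB] B(2) y(1) by blast
  \<comment> \<open>\<open>N\<close> covers \<open>y\<close> through \<open>B\<close> and misses
    \<open>x\<close>, so trading \<open>B\<close> for \<open>A\<close> gives a matching of the same
    size. It still misses \<open>t\<close>, because \<open>x \<noteq> t\<close> and \<open>y\<close>
    is covered by \<open>N\<close>, but it shares one more edge with \<open>M\<close>.\<close>
  define N' where "N' = insert A (N - {B})"
  have disj: "A \<inter> \<Union>(N - {B}) = {}"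
  proof -
    have "C \<inter> A = {}" if C: "C \<in> N" "C \<noteq> B" for C
      using matching_disjoint[OF Nm C(1) B(1) C(2)] C(1) B(2) x(2) y(1) by blast
    then show ?thesis by blast
  qed
  have m': "matching E V N'"
    unfolding N'_def using A2 disj by (intro matching_insert matching_subset[OF Nm]) auto
  have "card N' = card N"
    unfolding N'_def using B AN finN by (metis Diff_iff card.remove card_insert_disjoint finite_Diff)
  then have max': "max_matching E V N'" using m' Nmax by (simp add: max_matching_def)
  have "t \<notin> \<Union>N'" unfolding N'_def using tN y x \<open>y \<in> \<Union>N\<close> by auto
  then have "card (M \<inter> N') \<le> card (M \<inter> N)" using best max' by blast
  moreover have "M \<inter> N' = insert A (M \<inter> N)" unfolding N'_def using A \<open>B \<notin> M\<close> by auto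
  ultimately show False using AN finM by simp
qed

text \<open>By Gallai's lemma, not being missed together by any maximum matching is an equivalence
  relation; \<open>\<K>\<close> consists of its classes. The ends of an edge are related, since an
  edge missed at both ends could be added. A maximum matching missing one vertex of a class covers
  the others in pairs, so the class is odd. Parity and the relation then leave exactly one vertex of
  each class missed by \<open>M\<close>.\<close>

lemma gallai_classes:
  assumes fin: "finite V" and miss: "\<And>v. v \<in> V \<Longrightarrow> \<exists>N. max_matching E V N \<and> v \<notin> \<Union>N"
    and M: "max_matching E V M"
  shows "\<exists>\<K>. disjoint \<K> \<and> (\<forall>K \<in> \<K>. K \<subseteq> V \<and> odd (card K) \<and>
      (\<forall>A \<in> E. card A = 2 \<and> A \<subseteq> V \<and> A \<inter> K \<noteq> {} \<longrightarrow> A \<subseteq> K)) \<and> card \<K> = card (V - \<Union>M)"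
proof -
  define r where "r = {(u, v). u \<in> V \<and> v \<in> V \<and>
      (u = v \<or> (\<forall>M. max_matching E V M \<longrightarrow> u \<in> \<Union>M \<or> v \<in> \<Union>M))}"
  have "trans r"
  proof (rule transI)
    fix u t v assume 1: "(u, t) \<in> r" "(t, v) \<in> r"
    show "(u, v) \<in> r"
    proof (cases "u = v \<or> u = t \<or> t = v")
      case True then show ?thesis using 1 by (auto simp: r_def)
    next
      case False
      then have "\<forall>M. max_matching E V M \<longrightarrow> u \<in> \<Union>M \<or> v \<in> \<Union>M"
        using gallai_transitive[OF fin miss[of t], of u v] 1 unfolding r_def by blast
      then show ?thesis using 1 by (simp add: r_def)
    qed
  qed
  moreover have "refl_on V r" "r \<subseteq> V \<times> V" by (auto simp: r_def refl_on_def)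
  moreover have "sym r" by (auto simp: r_def sym_def)
  ultimately have eqv: "equiv V r" by (auto simp: equiv_def)
  have same: "(u, v) \<in> r" if "K \<in> V // r" "u \<in> K" "v \<in> K" for K u v
    using that eqv by (meson quotient_eq_iff)
  have KV: "K \<subseteq> V" if "K \<in> V // r" for K
    using that eqv by (metis Union_quotient Union_upper)
  have closed: "A \<subseteq> K" if K: "K \<in> V // r" and A: "A \<in> E" "card A = 2" "A \<subseteq> V" "A \<inter> K \<noteq> {}" for K A
  proof
    fix b assume b: "b \<in> A"
    obtain a where a: "a \<in> A" "a \<in> K" using A(4) by blast
    have "(a, b) \<in> r"
    proof (cases "a = b")
      case False
      then have "A = {a, b}" using A(2) a b by (auto simp: card_2_iff)
      then show ?thesis
        using max_matching_meets_edge[OF fin _ A(1,3,2)] A(3) unfolding r_def by auto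
    qed (use A b in \<open>auto simp: r_def\<close>)
    then show "b \<in> K" using in_quotient_imp_closed[OF eqv K a(2)] by blast
  qed
  have even_part: "even (card (K \<inter> \<Union>N))" if "K \<in> V // r" "max_matching E V N" for K N
  proof (rule even_card_closed_Int_matching)
    show N: "matching E V N" using that(2) by (simp add: max_matching_def)
    show "\<forall>A \<in> N. A \<inter> K \<noteq> {} \<longrightarrow> A \<subseteq> K"
      using closed[OF that(1)] N unfolding matching_def by blast
  qed
  have odd: "odd (card K)" if K: "K \<in> V // r" for K
  proof -
    obtain v where v: "v \<in> K" using K eqv in_quotient_imp_non_empty by blast
    then obtain N where N: "max_matching E V N" "v \<notin> \<Union>N" using miss KV K by blast
    have "x \<in> \<Union>N" if "x \<in> K" "x \<noteq> v" for x
      using same[OF K v that(1)] that(2) N unfolding r_def by blast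
    then have "K - {v} = K \<inter> \<Union>N" using N(2) by blast
    then have "even (card (K - {v}))" using even_part K N by simp
    then show ?thesis using v fin KV[OF K] by (metis card_Suc_Diff1 even_Suc finite_subset)
  qed
  have one: "\<exists>!v. v \<in> K \<and> v \<notin> \<Union>M" if K: "K \<in> V // r" for K
  proof -
    have "\<not> K \<subseteq> \<Union>M" using odd[OF K] even_part[OF K M] by (metis inf.absorb1)
    then show ?thesis using same[OF K] M unfolding r_def by blast
  qed
  have "bij_betw (\<lambda>v. r `` {v}) (V - \<Union>M) (V // r)"
  proof (rule bij_betwI')
    fix x y assume x: "x \<in> V - \<Union>M" and y: "y \<in> V - \<Union>M"
    show "(r `` {x} = r `` {y}) = (x = y)"
      using x y one[OF quotientI[of x V r]] equiv_class_self[OF eqv] by blast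
  next
    fix x assume "x \<in> V - \<Union>M" then show "r `` {x} \<in> V // r" by (auto intro: quotientI)
  next
    fix K assume K: "K \<in> V // r"
    then obtain v where v: "v \<in> K" "v \<notin> \<Union>M" using one by blast
    obtain w where w: "K = r `` {w}" using K by (auto elim: quotientE)
    then have "K = r `` {v}" using v(1) equiv_class_eq[OF eqv, of w v] by simp
    then show "\<exists>x \<in> V - \<Union>M. K = r `` {x}" using v KV[OF K] by blast
  qed
  then have "card (V // r) = card (V - \<Union>M)" by (simp add: bij_betw_same_card)
  moreover have "disjoint (V // r)"
    using quotient_disj[OF eqv] by (auto simp: pairwise_def disjnt_def)
  ultimately show ?thesis using KV odd closed by blast
qed

text \<open>Induction on \<open>card V\<close>. If every vertex is missed by some maximum matching,
  the empty barrier works by \<open>gallai_classes\<close>. Otherwise a vertex covered by all of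
  them is deleted and joins the barrier; its deletion raises the number of uncovered vertices by
  one, which pays for the new member of the barrier.\<close>

theorem tutte_berge:
  assumes "finite V"
  shows "\<exists>M U \<K>. max_matching E V M \<and> U \<subseteq> V \<and> disjoint \<K> \<and>
    (\<forall>K \<in> \<K>. K \<subseteq> V - U \<and> odd (card K) \<and>
      (\<forall>A \<in> E. card A = 2 \<and> A \<subseteq> V \<and> A \<inter> K \<noteq> {} \<longrightarrow> A \<subseteq> K \<union> U)) \<and>
    card \<K> = card U + card (V - \<Union>M)"
  using assms
proof (induction "card V" arbitrary: V rule: less_induct)
  case less
  obtain M where M: "max_matching E V M" using max_matching_exists less.prems by blast
  have Mm: "matching E V M" using M by (simp add: max_matching_def)
  show ?case
  proof (cases "\<forall>v \<in> V. \<exists>N. max_matching E V N \<and> v \<notin> \<Union>N")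
    case True
    then obtain \<K> where "disjoint \<K>" "\<forall>K \<in> \<K>. K \<subseteq> V \<and> odd (card K) \<and>
      (\<forall>A \<in> E. card A = 2 \<and> A \<subseteq> V \<and> A \<inter> K \<noteq> {} \<longrightarrow> A \<subseteq> K)" "card \<K> = card (V - \<Union>M)"
      using gallai_classes[OF less.prems _ M] by blast
    then show ?thesis using M by (intro exI[of _ M] exI[of _ "{}"] exI[of _ \<K>]) auto
  next
    case False
    then obtain v where v: "v \<in> V" "\<And>N. max_matching E V N \<Longrightarrow> v \<in> \<Union>N" by blast
    let ?W = "V - {v}"
    have "card ?W < card V" using v less.prems by (meson card_Diff1_less)
    then obtain M' U \<K> where IH: "max_matching E ?W M'" "U \<subseteq> ?W" "disjoint \<K>"
      "\<forall>K \<in> \<K>. K \<subseteq> ?W - U \<and> odd (card K) \<and>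
        (\<forall>A \<in> E. card A = 2 \<and> A \<subseteq> ?W \<and> A \<inter> K \<noteq> {} \<longrightarrow> A \<subseteq> K \<union> U)"
      "card \<K> = card U + card (?W - \<Union>M')"
      using less.hyps[of ?W] less.prems by auto
    have M': "matching E ?W M'" using IH(1) by (simp add: max_matching_def)
    then have M'V: "matching E V M'" "v \<notin> \<Union>M'" unfolding matching_def by auto
    have "\<not> max_matching E V M'" using v(2) M'V(2) by blast
    \<comment> \<open>A matching of \<open>?W\<close> as large as \<open>M\<close> would be a
      maximum matching of \<open>V\<close> that misses \<open>v\<close>.\<close>
    then have lt: "card M' < card M"
      using M M'V(1) unfolding max_matching_def by (metis le_trans linorder_not_le)
    obtain A where A: "A \<in> M" "v \<in> A" using v(2)[OF M] by blast
    have "\<Union>(M - {A}) \<subseteq> ?W"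
    proof -
      have "v \<notin> B" if "B \<in> M" "B \<noteq> A" for B
        using matching_disjoint[OF Mm that(1) A(1) that(2)] A(2) by blast
      moreover have "\<Union>M \<subseteq> V" using Mm by (simp add: matching_def)
      ultimately show ?thesis by blast
    qed
    \<comment> \<open>Conversely, dropping the edge at \<open>v\<close> costs only one, so deleting
      \<open>v\<close> lowers the matching number by exactly one.\<close>
    then have "matching E ?W (M - {A})"
      using matching_subset[OF Mm, of "M - {A}"] unfolding matching_def by blast
    then have "card (M - {A}) \<le> card M'" using IH(1) by (simp add: max_matching_def)
    then have c: "card M = card M' + 1"
      using lt A matching_finite[OF less.prems Mm] by simp
    have "card (V - \<Union>M) + 2 * card M = card V"
      using card_uncovered[OF less.prems Mm] .
    moreover have "card (?W - \<Union>M') + 2 * card M' = card ?W"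
      using card_uncovered[OF _ M'] less.prems by blast
    moreover have "card V = card ?W + 1" 
      using card_Suc_Diff1[OF less.prems v(1)] by simp
    ultimately have d: "card (?W - \<Union>M') = card (V - \<Union>M) + 1" using c by simp
    have "finite U" "v \<notin> U" using IH(2) less.prems finite_subset by (blast, blast)
    then have cU: "card \<K> = card (insert v U) + card (V - \<Union>M)" using IH(5) d by simp
    have closed: "A \<subseteq> K \<union> insert v U"
      if K: "K \<in> \<K>" and A: "A \<in> E" "card A = 2" "A \<subseteq> V" "A \<inter> K \<noteq> {}" for K A
    proof (cases "v \<in> A")
      case True
      obtain a where "a \<in> A" "a \<in> K" using A by blast
      moreover have "a \<noteq> v" using calculation K IH(4) by blast
      ultimately have "A = {v, a}" using True A(2) by (auto simp: card_2_iff)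
      then show ?thesis using \<open>a \<in> K\<close> by blast
    next
      case False
      then show ?thesis using IH(4) K A by blast
    qed
    have "K \<subseteq> V - insert v U \<and> odd (card K)" if "K \<in> \<K>" for K
      using IH(4) that by blast
    moreover have "insert v U \<subseteq> V" using IH(2) v(1) by blast
    ultimately show ?thesis
      using M IH(3) cU closed by (intro exI[of _ M] exI[of _ "insert v U"] exI[of _ \<K>]) simp
  qed
qed

section \<open>Edge boundaries and Petersen's theorem\<close>

text \<open>The formula of \<open>edge_cut\<close> for an arbitrary side \<open>X\<close>, so that
  degree counts and flow conditions also cover the empty set and the whole vertex set, whose
  boundary is empty.\<close>

definition boundary :: "('v, 'e) graph \<Rightarrow> 'v set \<Rightarrow> 'e set" where
  "boundary G X = {e \<in> edges G. ends G e \<inter> X \<noteq> {} \<and> ends G e \<inter> (verts G - X) \<noteq> {}}"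

lemma spanning_subgraph_simps [simp]:
  "verts (spanning_subgraph G F) = verts G"
  "edges (spanning_subgraph G F) = F"
  "ends (spanning_subgraph G F) = ends G"
  by (simp_all add: spanning_subgraph_def)

lemma delete_edges_simps [simp]:
  "verts (delete_edges G X) = verts G"
  "edges (delete_edges G X) = edges G - X"
  "ends (delete_edges G X) = ends G"
  by (simp_all add: delete_edges_def)

lemma finite_graph_spanning_subgraph:
  "finite_graph G \<Longrightarrow> F \<subseteq> edges G \<Longrightarrow> finite_graph (spanning_subgraph G F)"
  unfolding finite_graph_def by (auto intro: finite_subset)

lemma boundary_spanning_subgraph: "F \<subseteq> edges G \<Longrightarrow> boundary (spanning_subgraph G F) X = boundary G X \<inter> F"
  unfolding boundary_def by auto

lemma finite_boundary: "finite_graph G \<Longrightarrow> finite (boundary G X)"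
  unfolding finite_graph_def boundary_def by simp

lemma boundary_complement: "X \<subseteq> verts G \<Longrightarrow> boundary G (verts G - X) = boundary G X"
  unfolding boundary_def by (auto simp: double_diff)

lemma finite_graph_ends:
  assumes "finite_graph G" "e \<in> edges G" "a \<in> ends G e" "b \<in> ends G e" "a \<noteq> b"
  shows "ends G e = {a, b}"
proof -
  have "card (ends G e) \<in> {1, 2}" "finite (ends G e)"
    using assms(1,2) unfolding finite_graph_def by (auto intro: finite_subset)
  moreover have "card {a, b} = 2" "{a, b} \<subseteq> ends G e" using assms by auto
  ultimately show ?thesis
    by (metis card_mono card_subset_eq insertE le_antisym one_le_numeral singletonD)
qed

text \<open>Double counting of incidences: an edge inside \<open>X\<close>, be it a loop or not,
  contributes 2, and an edge of the boundary contributes 1.\<close>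

lemma sum_degree:
  assumes fin: "finite_graph G" and X: "X \<subseteq> verts G"
  shows "(\<Sum>v \<in> X. degree G v) = 2 * card {e \<in> edges G. ends G e \<subseteq> X} + card (boundary G X)"
proof -
  have finE: "finite (edges G)" and finX: "finite X"
    using fin X by (auto simp: finite_graph_def intro: finite_subset)
  have "(\<Sum>v \<in> X. degree G v) =
      (\<Sum>v \<in> X. \<Sum>e \<in> edges G. of_bool (v \<in> ends G e) + of_bool (ends G e = {v}))"
    unfolding degree_def using finE by (simp add: sum.distrib Int_def)
  also have "\<dots> = (\<Sum>e \<in> edges G. \<Sum>v \<in> X. of_bool (v \<in> ends G e) + of_bool (ends G e = {v}))"
    by (rule sum.swap)
  also have "\<dots> = (\<Sum>e \<in> edges G. 2 * of_bool (ends G e \<subseteq> X) + of_bool (e \<in> boundary G X))"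
  proof (rule sum.cong)
    fix e assume e: "e \<in> edges G"
    have sub: "ends G e \<subseteq> verts G" and "card (ends G e) = 1 \<or> card (ends G e) = 2"
      using fin e by (auto simp: finite_graph_def)
    then consider a where "ends G e = {a}" | a b where "a \<noteq> b" "ends G e = {a, b}"
      by (metis card_1_singletonE card_2_iff)
    then have "card (X \<inter> ends G e) + card (X \<inter> {v. ends G e = {v}}) =
        2 * of_bool (ends G e \<subseteq> X) + of_bool (e \<in> boundary G X)"
    proof cases
      case 1
      then show ?thesis using e sub by (auto simp: boundary_def)
    next
      case 2
      have "{v. ends G e = {v}} = {}" using 2 by auto
      then show ?thesis using e sub 2 by (auto simp: boundary_def)
    qed
    then show "(\<Sum>v \<in> X. of_bool (v \<in> ends G e) + of_bool (ends G e = {v})) =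
        2 * of_bool (ends G e \<subseteq> X) + (of_bool (e \<in> boundary G X) :: nat)"
      using finX by (simp add: sum.distrib Int_def)
  qed simp
  also have "\<dots> = 2 * card {e \<in> edges G. ends G e \<subseteq> X} + card (boundary G X)"
  proof -
    have "{e \<in> edges G. e \<in> boundary G X} = boundary G X" by (auto simp: boundary_def)
    then show ?thesis using finE by (simp add: sum.distrib Int_def flip: sum_distrib_left)
  qed
  finally show ?thesis .
qed

text \<open>Supplies the parity of cuts: \<open>card (boundary G X)\<close> and
  \<open>r * card X\<close> differ by an even number.\<close>

lemma regular_sum_degree:
  assumes "finite_graph G" "regular r G" "X \<subseteq> verts G"
  shows "r * card X = 2 * card {e \<in> edges G. ends G e \<subseteq> X} + card (boundary G X)"
proof -
  have "(\<Sum>v \<in> X. degree G v) = (\<Sum>v \<in> X. r)"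
    using assms(2,3) by (intro sum.cong) (auto simp: regular_def)
  then show ?thesis using sum_degree[OF assms(1,3)] by (simp add: mult.commute)
qed

section \<open>Connected components and bridges\<close>

lemma sym_adjacency: "sym (adjacency G)"
  by (auto simp: sym_def adjacency_def insert_commute)

lemma equiv_connectedness: "equiv (verts G) (connectedness G)"
proof (rule equivI)
  show "connectedness G \<subseteq> verts G \<times> verts G" "refl_on (verts G) (connectedness G)"
    by (auto simp: connectedness_def refl_on_def)
  show "sym (connectedness G)"
    using sym_rtrancl[OF sym_adjacency, of G] by (auto simp: connectedness_def sym_def)
  show "trans (connectedness G)"
    unfolding connectedness_def trans_def by (auto intro: rtrancl_trans)
qed

lemma card_components: "card (components G) = card (verts G // connectedness G)"
proof -
  have "inj_on (induced_subgraph G) (verts G // connectedness G)"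
    by (rule inj_on_inverseI[where g = verts]) (simp add: induced_subgraph_def)
  then show ?thesis by (simp add: components_def card_image)
qed

lemma reachable_boundary_empty:
  assumes fin: "finite_graph G" and "boundary G X = {}" "(a, b) \<in> (adjacency G)\<^sup>*" "a \<in> X"
  shows "b \<in> X"
  using assms(3,4)
proof (induction rule: rtrancl_induct)
  case (step y z)
  then obtain e where e: "e \<in> edges G" "ends G e = {y, z}" by (auto simp: adjacency_def)
  then have "z \<in> verts G" using fin by (auto simp: finite_graph_def)
  moreover have "e \<notin> boundary G X" using assms(2) by blast
  ultimately show ?case using e step unfolding boundary_def by blast
qed

lemma component_boundary_empty:
  assumes fin: "finite_graph G" and K: "K \<in> verts G // connectedness G"
  shows "boundary G K = {}"
proof (rule ccontr)
  assume "boundary G K \<noteq> {}"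
  then obtain e a b where e: "e \<in> edges G" "a \<in> ends G e" "a \<in> K" "b \<in> ends G e" "b \<in> verts G" "b \<notin> K"
    unfolding boundary_def by blast
  then have "ends G e = {a, b}" using finite_graph_ends[OF fin] by blast
  then have "(a, b) \<in> adjacency G" using e by (auto simp: adjacency_def)
  moreover have "a \<in> verts G" using K e(3) in_quotient_imp_subset[OF equiv_connectedness] by blast
  ultimately have "(a, b) \<in> connectedness G" using e by (auto simp: connectedness_def)
  then show False using in_quotient_imp_closed[OF equiv_connectedness K e(3)] e by blast
qed

text \<open>No path leaves a set with empty boundary. The connectedness of circuits is used later in
  this form.\<close>

lemma component_minimal:
  assumes fin: "finite_graph G" and K: "K \<in> verts G // connectedness G"
    and Y: "Y \<subseteq> K" "Y \<noteq> {}" "boundary G Y = {}"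
  shows "Y = K"
proof
  obtain a where a: "a \<in> Y" using Y by blast
  show "K \<subseteq> Y"
  proof
    fix b assume "b \<in> K"
    then have "(a, b) \<in> connectedness G"
      using in_quotient_imp_in_rel[OF equiv_connectedness K] a Y by blast
    then show "b \<in> Y" using reachable_boundary_empty[OF fin Y(3) _ a] by (auto simp: connectedness_def)
  qed
qed (rule Y)

lemma finite_components:
  "finite_graph G \<Longrightarrow> finite (verts G // connectedness G)"
  by (auto simp: finite_graph_def connectedness_def intro!: finite_quotient)

text \<open>If \<open>e\<close> were the only edge leaving \<open>X\<close>, its deletion would
  disconnect its ends. The map from the components after deletion to those of \<open>G\<close> is
  then onto but not injective, so their number grows and \<open>e\<close> is a bridge in the
  counting sense of \<open>bridge\<close>.\<close>

lemma bridgeless_card_boundary: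
  assumes fin: "finite_graph G" and bl: "bridgeless G" and X: "X \<subseteq> verts G"
  shows "card (boundary G X) \<noteq> 1"
proof
  assume "card (boundary G X) = 1"
  then obtain e where boundary: "boundary G X = {e}" by (auto simp: card_1_singleton_iff)
  then have "e \<in> boundary G X" by simp
  then obtain a b where e: "e \<in> edges G" "a \<in> ends G e" "a \<in> X" "b \<in> ends G e" "b \<in> verts G" "b \<notin> X"
    unfolding boundary_def by blast
  then have ends: "ends G e = {a, b}" using finite_graph_ends[OF fin] by blast
  have aV: "a \<in> verts G" using e X by blast
  let ?H = "delete_edges G {e}"
  let ?R = "connectedness G" and ?R' = "connectedness ?H" and ?V = "verts G"
  have finH: "finite_graph ?H" using fin by (auto simp: finite_graph_def)
  have eq: "equiv ?V ?R" and eq': "equiv ?V ?R'"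
    using equiv_connectedness[of G] equiv_connectedness[of ?H] by simp_all
  have ab: "(a, b) \<in> ?R" using e ends aV by (auto simp: connectedness_def adjacency_def)
  have "boundary ?H X = {}" using boundary by (auto simp: boundary_def)
  then have nab: "(a, b) \<notin> ?R'"
    using reachable_boundary_empty[OF finH, of X a b] e by (auto simp: connectedness_def)
  have "adjacency ?H \<subseteq> adjacency G" by (auto simp: adjacency_def)
  then have sub: "?R' \<subseteq> ?R" using rtrancl_mono by (auto simp: connectedness_def)
  have img: "?R `` (?R' `` {v}) = ?R `` {v}" if "v \<in> ?V" for v
    using sub eq eq' that unfolding equiv_def refl_on_def trans_def by blast
  have surj: "(\<lambda>K. ?R `` K) ` (?V // ?R') = ?V // ?R"
    unfolding quotient_def using img by auto
  have finq: "finite (?V // ?R')" using finite_components[OF finH] by simp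
  have "\<not> inj_on (\<lambda>K. ?R `` K) (?V // ?R')"
  proof
    assume inj: "inj_on (\<lambda>K. ?R `` K) (?V // ?R')"
    have "?R `` {a} = ?R `` {b}" using equiv_class_eq[OF eq ab] .
    then have "?R `` (?R' `` {a}) = ?R `` (?R' `` {b})" using img aV e by simp
    then have "?R' `` {a} = ?R' `` {b}"
      using inj aV e by (auto simp: inj_on_def quotientI)
    then show False using nab eq_equiv_class[OF _ eq'] e by blast
  qed
  then have "card (?V // ?R) < card (?V // ?R')"
    using card_image_le[OF finq, of "\<lambda>K. ?R `` K"] eq_card_imp_inj_on[OF finq, of "\<lambda>K. ?R `` K"]
    unfolding surj by linarith
  then have "bridge G e" using e by (simp add: bridge_def card_components)
  then show False using bl e by (simp add: bridgeless_def)
qed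

section \<open>Loops and degrees\<close>

definition loopless :: "('v, 'e) graph \<Rightarrow> bool" where
  "loopless G \<longleftrightarrow> (\<forall>e \<in> edges G. card (ends G e) = 2)"

lemma loopless_ends:
  assumes "loopless G" "e \<in> edges G"
  obtains a b where "ends G e = {a, b}" "a \<noteq> b"
  using assms that unfolding loopless_def by (meson card_2_iff)

text \<open>A loop uses up two of the three degrees of its vertex, so the third edge there would be
  a cut of size 1.\<close>

lemma bridgeless_cubic_loopless:
  assumes fin: "finite_graph G" and "cubic G" "bridgeless G"
  shows "loopless G"
  unfolding loopless_def
proof (rule ballI, rule ccontr)
  fix e assume e: "e \<in> edges G" and "card (ends G e) \<noteq> 2"
  then have "card (ends G e) = 1" "ends G e \<subseteq> verts G" using fin by (auto simp: finite_graph_def)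
  then obtain v where v: "ends G e = {v}" "v \<in> verts G" by (auto simp: card_1_singleton_iff)
  let ?L = "{e \<in> edges G. ends G e \<subseteq> {v}}"
  have "3 = 2 * card ?L + card (boundary G {v})"
    using regular_sum_degree[OF fin assms(2), of "{v}"] v by simp
  moreover have "card ?L \<noteq> 0" using fin e v by (auto simp: finite_graph_def)
  ultimately have "card (boundary G {v}) = 1" by presburger
  then show False using bridgeless_card_boundary[OF fin assms(3), of "{v}"] v by simp
qed

lemma loopless_degree:
  assumes "loopless G" shows "degree G v = card {e \<in> edges G. v \<in> ends G e}"
proof -
  have "{e \<in> edges G. ends G e = {v}} = {}" using assms by (auto simp: loopless_def)
  then show ?thesis unfolding degree_def by (simp only: card.empty add_0_right)
qed

lemma loopless_spanning_subgraph:
  "loopless G \<Longrightarrow> F \<subseteq> edges G \<Longrightarrow> loopless (spanning_subgraph G F)"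
  by (auto simp: loopless_def)

text \<open>Each member of \<open>\<K>\<close> sends at least \<open>r\<close> edges into
  \<open>U\<close>, different members send different edges, and \<open>U\<close> receives at most
  \<open>r * card U\<close>. Applied with \<open>r = 3\<close> for Petersen's theorem and with
  \<open>r = 2\<close> for circuits.\<close>

lemma card_family_le:
  assumes fin: "finite_graph G" and reg: "regular r G" and "r > 0" and U: "U \<subseteq> verts G"
    and disj: "disjoint \<K>" and KV: "\<And>K. K \<in> \<K> \<Longrightarrow> K \<subseteq> verts G - U"
    and closed: "\<And>K e. K \<in> \<K> \<Longrightarrow> e \<in> boundary G K \<Longrightarrow> ends G e \<subseteq> K \<union> U"
    and big: "\<And>K. K \<in> \<K> \<Longrightarrow> r \<le> card (boundary G K)"
  shows "card \<K> \<le> card U"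
proof -
  have "finite (verts G)" using fin by (simp add: finite_graph_def)
  then have finK: "finite \<K>" using KV by (intro finite_subset[of \<K> "Pow (verts G)"]) auto
  have cross: "e \<in> boundary G U" if "K \<in> \<K>" "e \<in> boundary G K" for K e
    using closed[OF that] that(2) KV[OF that(1)] unfolding boundary_def by blast
  have "boundary G K \<inter> boundary G L = {}" if K: "K \<in> \<K>" and L: "L \<in> \<K>" and "K \<noteq> L" for K L
  proof (rule ccontr)
    assume "boundary G K \<inter> boundary G L \<noteq> {}"
    then obtain e where e: "e \<in> boundary G K" "e \<in> boundary G L" by blast
    have KL: "K \<inter> L = {}" using disj K L \<open>K \<noteq> L\<close> by (meson disjointD)
    have sub: "ends G e \<subseteq> U" using closed[OF K e(1)] closed[OF L e(2)] KL by blast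
    show False using sub e(1) KV[OF K] unfolding boundary_def by blast
  qed
  then have "(\<Sum>K \<in> \<K>. card (boundary G K)) = card (\<Union>K \<in> \<K>. boundary G K)"
    using finK finite_boundary[OF fin] by (subst card_UN_disjoint) auto
  also have "\<dots> \<le> card (boundary G U)"
    using cross finite_boundary[OF fin] by (intro card_mono) auto
  also have "\<dots> \<le> r * card U" using regular_sum_degree[OF fin reg U] by simp
  finally have "(\<Sum>K \<in> \<K>. card (boundary G K)) \<le> r * card U" .
  moreover have "r * card \<K> \<le> (\<Sum>K \<in> \<K>. card (boundary G K))"
    using sum_mono[of \<K> "\<lambda>_. r" "\<lambda>K. card (boundary G K)"] big by (simp add: mult.commute)
  ultimately show ?thesis using \<open>r > 0\<close> by (meson le_trans mult_le_cancel1)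
qed

text \<open>Picks one edge from each parallel class that the matching of vertex pairs uses.\<close>

lemma matching_edges:
  assumes "matching (ends G ` E) V M"
  obtains N where "N \<subseteq> E" "inj_on (ends G) N" "ends G ` N = M"
  using assms that unfolding matching_def by (metis subset_image_inj)

text \<open>An odd vertex set in a cubic graph has an odd cut, and a cut of size 1 is excluded, so
  at least three edges leave it. Hence the barrier of Tutte and Berge has at least as many vertices
  as there are odd sets, and nothing stays uncovered.\<close>

theorem petersen:
  assumes fin: "finite_graph G" and cubic: "cubic G" and bl: "bridgeless G"
  shows "\<exists>M. is_factor 1 G M"
proof -
  have ll: "loopless G" using bridgeless_cubic_loopless assms by blast
  let ?V = "verts G" and ?E = "ends G ` edges G"
  have finV: "finite ?V" using fin by (simp add: finite_graph_def)
  obtain M U \<K> where M: "max_matching ?E ?V M" and U: "U \<subseteq> ?V" and disj: "disjoint \<K>"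
    and \<K>: "\<forall>K \<in> \<K>. K \<subseteq> ?V - U \<and> odd (card K) \<and>
      (\<forall>A \<in> ?E. card A = 2 \<and> A \<subseteq> ?V \<and> A \<inter> K \<noteq> {} \<longrightarrow> A \<subseteq> K \<union> U)"
    and card: "card \<K> = card U + card (?V - \<Union>M)"
    using tutte_berge[OF finV] by meson
  have "card \<K> \<le> card U"
  proof (rule card_family_le[OF fin cubic _ U disj])
    fix K assume K: "K \<in> \<K>"
    show "K \<subseteq> ?V - U" using \<K> K by blast
    then have KV: "K \<subseteq> ?V" by blast
    have "odd (3 * card K)" using \<K> K by simp
    then have "odd (card (boundary G K))" using regular_sum_degree[OF fin cubic KV] by simp
    moreover have "card (boundary G K) \<noteq> 1" using bridgeless_card_boundary[OF fin bl KV] .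
    ultimately show "3 \<le> card (boundary G K)" by presburger
    fix e assume "e \<in> boundary G K"
    then have "e \<in> edges G" "ends G e \<inter> K \<noteq> {}" by (auto simp: boundary_def)
    then show "ends G e \<subseteq> K \<union> U"
      using \<K> K ll fin unfolding loopless_def finite_graph_def by blast
  qed simp
  then have "card (?V - \<Union>M) = 0" using card by simp
  then have cover: "?V \<subseteq> \<Union>M" using finV by simp
  have Mm: "matching ?E ?V M" using M by (simp add: max_matching_def)
  obtain N where N: "N \<subseteq> edges G" "inj_on (ends G) N" "ends G ` N = M"
    using matching_edges[OF Mm] by blast
  have "card {e \<in> N. v \<in> ends G e} = 1" if v: "v \<in> ?V" for v
  proof -
    obtain e where e: "e \<in> N" "v \<in> ends G e" using cover v N(3) by blast
    have "f = e" if f: "f \<in> N" "v \<in> ends G f" for f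
      using matching_disjoint[OF Mm, of "ends G e" "ends G f"] N e f
      by (metis disjoint_iff imageI inj_on_def)
    then have "{e \<in> N. v \<in> ends G e} = {e}" using e by blast
    then show ?thesis by simp
  qed
  then have "is_factor 1 G N"
    using N(1) loopless_degree[OF loopless_spanning_subgraph[OF ll N(1)]]
    by (simp add: is_factor_def regular_def)
  then show ?thesis by blast
qed

section \<open>Flows with prescribed net outflow\<close>

text \<open>
  An antisymmetric flow is given by its values \<open>g e v\<close>, the amount leaving the end \<open>v\<close> of \<open>e\<close>
  along \<open>e\<close>; a negative amount is flow that arrives.
\<close>

definition odd_flow :: "int \<Rightarrow> ('v, 'e) graph \<Rightarrow> ('e \<Rightarrow> 'v \<Rightarrow> int) \<Rightarrow> bool" where
  "odd_flow c G g \<longleftrightarrow> (\<forall>e \<in> edges G. sum (g e) (ends G e) = 0 \<and>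
     (\<forall>v \<in> ends G e. odd (g e v) \<and> \<bar>g e v\<bar> \<le> c))"

definition outflow :: "('v, 'e) graph \<Rightarrow> ('e \<Rightarrow> 'v \<Rightarrow> int) \<Rightarrow> 'v \<Rightarrow> int" where
  "outflow G g v = (\<Sum>e | e \<in> edges G \<and> v \<in> ends G e. g e v)"

text \<open>An arc from \<open>u\<close> to \<open>w\<close> says that the amount leaving
  \<open>u\<close> along the edge can be lowered. As the values and \<open>c\<close> are odd, the
  strict inequality leaves room for a change by 2, which preserves oddness.\<close>

definition residual :: "int \<Rightarrow> ('v, 'e) graph \<Rightarrow> ('e \<Rightarrow> 'v \<Rightarrow> int) \<Rightarrow> ('v \<times> 'v) set" where
  "residual c G g = {(u, w). \<exists>e \<in> edges G. ends G e = {u, w} \<and> u \<noteq> w \<and> - c < g e u}"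

text \<open>Edges with both ends in \<open>X\<close> cancel by antisymmetry, so only the boundary
  contributes.\<close>

lemma sum_outflow:
  assumes fin: "finite_graph G" and g: "\<And>e. e \<in> edges G \<Longrightarrow> sum (g e) (ends G e) = 0"
    and X: "X \<subseteq> verts G"
  shows "(\<Sum>v \<in> X. outflow G g v) = (\<Sum>e \<in> boundary G X. sum (g e) (X \<inter> ends G e))"
proof -
  have finE: "finite (edges G)" and finX: "finite X"
    using fin X by (auto simp: finite_graph_def intro: finite_subset)
  have "(\<Sum>v \<in> X. outflow G g v) = (\<Sum>e \<in> edges G. sum (g e) (X \<inter> ends G e))"
    unfolding outflow_def by (subst sum.swap_restrict[OF finX finE]) (simp add: Int_def)
  also have "\<dots> = (\<Sum>e \<in> boundary G X. sum (g e) (X \<inter> ends G e))"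
  proof (rule sum.mono_neutral_right)
    show "\<forall>e \<in> edges G - boundary G X. sum (g e) (X \<inter> ends G e) = 0"
    proof
      fix e assume e: "e \<in> edges G - boundary G X"
      then have "ends G e \<subseteq> verts G" using fin by (auto simp: finite_graph_def)
      then have "X \<inter> ends G e = {} \<or> X \<inter> ends G e = ends G e" using e by (auto simp: boundary_def)
      then show "sum (g e) (X \<inter> ends G e) = 0" using g e by auto
    qed
  qed (use finE in \<open>auto simp: boundary_def\<close>)
  finally show ?thesis .
qed

text \<open>Detours through a repeated vertex are cut off. Distinctness is what keeps the later arcs
  of the chain residual while the flow is changed along the earlier ones.\<close>

lemma rtrancl_distinct_chain:
  assumes "(v, w) \<in> R\<^sup>*"
  shows "\<exists>xs. xs \<noteq> [] \<and> hd xs = v \<and> last xs = w \<and> distinct xs \<and> successively (\<lambda>a b. (a, b) \<in> R) xs"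
  using assms
proof (induction rule: converse_rtrancl_induct)
  case base
  show ?case by (intro exI[of _ "[w]"]) simp
next
  case (step v u)
  then obtain xs where xs: "xs \<noteq> []" "hd xs = u" "last xs = w" "distinct xs"
    "successively (\<lambda>a b. (a, b) \<in> R) xs" by blast
  show ?case
  proof (cases "v \<in> set xs")
    case True
    then obtain ys zs where "xs = ys @ v # zs" by (meson split_list)
    then show ?thesis using xs by (intro exI[of _ "v # zs"]) (auto simp: successively_append_iff)
  next
    case False
    then show ?thesis
      using xs step.hyps(1) by (intro exI[of _ "v # xs"]) (auto simp: successively_Cons)
  qed
qed

text \<open>Changing the first edge moves 2 units of outflow from \<open>v\<close> to
  \<open>w\<close>. The remaining chain avoids \<open>v\<close>, so its arcs come from other edges
  and stay residual for the new flow.\<close>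

lemma augment_chain:
  assumes fin: "finite_graph G" and c: "odd c"
  shows "\<lbrakk>xs \<noteq> []; distinct xs; successively (\<lambda>a b. (a, b) \<in> residual c G g) xs; odd_flow c G g\<rbrakk> \<Longrightarrow>
    \<exists>g'. odd_flow c G g' \<and> (\<forall>v. outflow G g' v = outflow G g v
      - 2 * of_bool (v = hd xs) + 2 * of_bool (v = last xs))"
proof (induction xs arbitrary: g rule: induct_list012)
  case (2 v)
  then show ?case by (intro exI[of _ g]) simp
next
  case (3 v w ys)
  have "(v, w) \<in> residual c G g" using "3.prems"(3) by simp
  then obtain e where e: "e \<in> edges G" "ends G e = {v, w}" "v \<noteq> w" "- c < g e v"
    by (auto simp: residual_def)
  define h where "h = g(e := (g e)(v := g e v - 2, w := g e w + 2))"
  have ge: "g e w = - g e v" "odd (g e v)" "\<bar>g e v\<bar> \<le> c"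
    using "3.prems"(4) e unfolding odd_flow_def by force+
  \<comment> \<open>Both \<open>g e v\<close> and \<open>- c\<close> are odd, so the strict
    inequality gains 2.\<close>
  have "2 - c \<le> g e v" using ge(2) e(4) c by presburger
  then have "\<bar>g e v - 2\<bar> \<le> c" "\<bar>2 - g e v\<bar> \<le> c" using ge(3) by linarith+
  then have flow: "odd_flow c G h"
    using "3.prems"(4) e ge unfolding odd_flow_def h_def by auto
  have chain: "successively (\<lambda>a b. (a, b) \<in> residual c G h) (w # ys)"
  proof (rule successively_mono)
    show "successively (\<lambda>a b. (a, b) \<in> residual c G g) (w # ys)" using "3.prems"(3) by simp
    fix a b assume ab: "a \<in> set (w # ys)" "b \<in> set (w # ys)" "(a, b) \<in> residual c G g"
    then have "v \<noteq> a" "v \<noteq> b" using "3.prems"(2) by auto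
    moreover obtain f where f: "f \<in> edges G" "ends G f = {a, b}" "a \<noteq> b" "- c < g f a"
      using ab(3) by (auto simp: residual_def)
    ultimately have "f \<noteq> e" using e(2) by auto
    then show "(a, b) \<in> residual c G h" using f by (auto simp: residual_def h_def)
  qed
  have "distinct (w # ys)" using "3.prems"(2) by simp
  then have "\<exists>g'. odd_flow c G g' \<and> (\<forall>x. outflow G g' x =
      outflow G h x - 2 * of_bool (x = hd (w # ys)) + 2 * of_bool (x = last (w # ys)))"
    by (intro "3.IH"(2) chain flow list.distinct(2))
  then obtain g' where g': "odd_flow c G g'" "\<And>x. outflow G g' x =
      outflow G h x - 2 * of_bool (x = w) + 2 * of_bool (x = last (w # ys))"
    unfolding list.sel by blast
  have "outflow G h x = outflow G g x - 2 * of_bool (x = v) + 2 * of_bool (x = w)" for x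
  proof -
    let ?S = "{e \<in> edges G. x \<in> ends G e}"
    let ?d = "- 2 * of_bool (x = v) + 2 * of_bool (x = w) :: int"
    have finS: "finite ?S" using fin by (simp add: finite_graph_def)
    have "outflow G h x = (\<Sum>f \<in> ?S. g f x + (if f = e then ?d else 0))"
      unfolding outflow_def h_def using e(3) by (intro sum.cong) auto
    also have "\<dots> = outflow G g x + (if e \<in> ?S then ?d else 0)"
      unfolding outflow_def using finS by (simp add: sum.distrib)
    also have "(if e \<in> ?S then ?d else 0) = ?d" using e by auto
    finally show ?thesis by simp
  qed
  then show ?case using g' by (intro exI[of _ g']) simp
qed simp

lemma even_outflow_iff:
  assumes "finite_graph G" "loopless G" "odd_flow c G g"
  shows "even (outflow G g v) \<longleftrightarrow> even (degree G v)"
proof -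
  let ?S = "{e \<in> edges G. v \<in> ends G e}"
  have "finite ?S" using assms(1) by (simp add: finite_graph_def)
  then have "even (outflow G g v) \<longleftrightarrow> even (card {e \<in> ?S. odd (g e v)})"
    unfolding outflow_def by (rule even_sum_iff)
  moreover have "{e \<in> ?S. odd (g e v)} = ?S" using assms(3) by (auto simp: odd_flow_def)
  ultimately show ?thesis using loopless_degree[OF assms(2)] by simp
qed

lemma odd_flow_exists:
  assumes ll: "loopless G" and "1 \<le> c"
  shows "\<exists>g. odd_flow c G g"
proof -
  \<comment> \<open>An arbitrary orientation of every edge, with value 1 at the chosen end.\<close>
  define g :: "'b \<Rightarrow> 'a \<Rightarrow> int" where "g e v = (if v = (SOME x. x \<in> ends G e) then 1 else - 1)" for e v
  have "sum (g e) (ends G e) = 0" if e: "e \<in> edges G" for e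
  proof -
    obtain a b where ab: "ends G e = {a, b}" "a \<noteq> b"
      using loopless_ends[OF ll e] .
    then have "(SOME x. x \<in> ends G e) \<in> {a, b}" by (metis insertI1 someI)
    then show ?thesis using ab by (auto simp: g_def)
  qed
  then have "odd_flow c G g" using assms(2) by (auto simp: odd_flow_def g_def)
  then show ?thesis by blast
qed

text \<open>
  The flow minimising the total deviation from the demand \<open>b\<close> meets it: otherwise the vertices
  reachable in the residual graph from a vertex with excess form a set \<open>X\<close> whose boundary is
  saturated inwards, and \<open>X\<close> violates the boundary condition.
\<close>

lemma odd_flow_with_demand:
  assumes fin: "finite_graph G" and ll: "loopless G" and c: "odd c" "1 \<le> c"
    and parity: "\<And>v. v \<in> verts G \<Longrightarrow> even (b v) \<longleftrightarrow> even (degree G v)"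
    and demand: "\<And>X. X \<subseteq> verts G \<Longrightarrow> \<bar>\<Sum>v \<in> X. b v\<bar> \<le> c * int (card (boundary G X))"
  shows "\<exists>g. odd_flow c G g \<and> (\<forall>v \<in> verts G. outflow G g v = b v)"
proof -
  let ?V = "verts G"
  have finV: "finite ?V" using fin by (simp add: finite_graph_def)
  define dev where "dev g = (\<Sum>v \<in> ?V. nat \<bar>outflow G g v - b v\<bar>)" for g
  obtain g where g: "odd_flow c G g" and least: "\<And>h. odd_flow c G h \<Longrightarrow> dev g \<le> dev h"
    using odd_flow_exists[OF ll c(2)] ex_has_least_nat[of "odd_flow c G" _ dev] by blast
  have g0: "\<And>e. e \<in> edges G \<Longrightarrow> sum (g e) (ends G e) = 0" using g by (simp add: odd_flow_def)
  have "outflow G g v = b v" if "v \<in> ?V" for v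
  proof (rule ccontr)
    assume neq: "outflow G g v \<noteq> b v"
    have cutV: "boundary G ?V = {}" by (auto simp: boundary_def)
    have "(\<Sum>v \<in> ?V. outflow G g v) = 0" using sum_outflow[OF fin g0, of ?V] cutV by simp
    moreover have "(\<Sum>v \<in> ?V. b v) = 0" using demand[of ?V] cutV by simp
    ultimately have sum0: "(\<Sum>v \<in> ?V. b v - outflow G g v) = 0" by (simp add: sum_subtractf)
    \<comment> \<open>The deviations sum to zero, so a nonzero one somewhere forces an excess
      somewhere.\<close>
    have "\<exists>u \<in> ?V. b u < outflow G g u"
    proof (rule ccontr)
      assume "\<not> (\<exists>u \<in> ?V. b u < outflow G g u)"
      then have "\<And>u. u \<in> ?V \<Longrightarrow> 0 \<le> b u - outflow G g u" by force
      then have "b v - outflow G g v = 0" using sum_nonneg_0[OF finV _ sum0 that] by simp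
      then show False using neq by simp
    qed
    then obtain u where u: "u \<in> ?V" "b u < outflow G g u" by blast
    define X where "X = {w \<in> ?V. (u, w) \<in> (residual c G g)\<^sup>*}"
    have uX: "u \<in> X" using u by (simp add: X_def)
    have XV: "X \<subseteq> ?V" by (auto simp: X_def)
    have finX: "finite X" using XV finV finite_subset by blast
    show False
    proof (cases "\<exists>w \<in> X. outflow G g w < b w")
      case True
      then obtain w where w: "w \<in> X" "outflow G g w < b w" by blast
      have wV: "w \<in> ?V" "(u, w) \<in> (residual c G g)\<^sup>*" using w by (auto simp: X_def)
      obtain xs where "xs \<noteq> []" "distinct xs" "successively (\<lambda>a b. (a, b) \<in> residual c G g) xs"
        and ends: "hd xs = u" "last xs = w"
        using rtrancl_distinct_chain[OF wV(2)] by blast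
      then obtain h where h: "odd_flow c G h" "\<And>x. outflow G h x = outflow G g x
          - 2 * of_bool (x = u) + 2 * of_bool (x = w)"
        using augment_chain[OF fin c(1), of xs g] g by auto
      have par: "even (outflow G g x) \<longleftrightarrow> even (b x)" if "x \<in> ?V" for x
        using even_outflow_iff[OF fin ll g] parity that by simp
      have "u \<noteq> w" using u w by auto
      \<comment> \<open>By parity, excess and deficit are at least 2, so moving 2 units does not
        overshoot.\<close>
      have 1: "b u + 2 \<le> outflow G g u" using par[OF u(1)] u(2) by presburger
      have 2: "outflow G g w + 2 \<le> b w" using par[OF wV(1)] w(2) by presburger
      have "dev h < dev g"
        unfolding dev_def
      proof (rule sum_strict_mono_ex1[OF finV])
        show "\<forall>x \<in> ?V. nat \<bar>outflow G h x - b x\<bar> \<le> nat \<bar>outflow G g x - b x\<bar>"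
          using 1 2 h(2) \<open>u \<noteq> w\<close> by auto
        show "\<exists>x \<in> ?V. nat \<bar>outflow G h x - b x\<bar> < nat \<bar>outflow G g x - b x\<bar>"
          using 1 h(2) \<open>u \<noteq> w\<close> u(1) by (intro bexI[of _ u]) auto
      qed
      then show False using least[OF h(1)] by simp
    next
      case False
      have "(\<Sum>v \<in> X. b v) < (\<Sum>v \<in> X. outflow G g v)"
        using False u uX by (intro sum_strict_mono_ex1[OF finX]) (auto simp: not_less)
      also have "\<dots> = (\<Sum>e \<in> boundary G X. sum (g e) (X \<inter> ends G e))"
        by (rule sum_outflow[OF fin g0 XV])
      also have "\<dots> \<le> (\<Sum>e \<in> boundary G X. - c)"
      proof (rule sum_mono)
        fix e assume "e \<in> boundary G X"
        then obtain x y where e: "e \<in> edges G" "x \<in> ends G e" "x \<in> X" "y \<in> ends G e" "y \<in> ?V" "y \<notin> X"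
          unfolding boundary_def by blast
        then have xy: "ends G e = {x, y}" "x \<noteq> y" using finite_graph_ends[OF fin] by blast+
        \<comment> \<open>Otherwise \<open>y\<close> would be reachable from \<open>u\<close> as
          well; so the edge is saturated towards \<open>X\<close>.\<close>
        have "(x, y) \<notin> residual c G g"
          using e by (auto simp: X_def intro: rtrancl_into_rtrancl)
        then have "g e x \<le> - c" using e xy by (force simp: residual_def)
        moreover have "X \<inter> ends G e = {x}" using e xy by auto
        ultimately show "sum (g e) (X \<inter> ends G e) \<le> - c" by simp
      qed
      also have "\<dots> = - (c * int (card (boundary G X)))" by simp
      finally show False using demand[OF XV] by linarith
    qed
  qed
  then show ?thesis using g by blast
qed

text \<open>
  The integral form of the theorem of Bondy and Jaeger on balanced valuations. If \<open>o\<close> is an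
  orientation with net outflow \<open>\<sigma>\<close> and \<open>g\<close> takes values in \<open>{\<plusminus>1, \<plusminus>3}\<close> and has net outflow
  \<open>-5 \<sigma>\<close>, then \<open>(5 o + g) / 2\<close> is a nowhere-zero 5-flow.
\<close>

lemma five_flow_from_balanced_valuation:
  assumes fin: "finite_graph G" and cubic: "cubic G" and ll: "loopless G"
    and sign: "\<And>v. v \<in> verts G \<Longrightarrow> odd (\<sigma> v)"
    and bal: "\<And>X. X \<subseteq> verts G \<Longrightarrow> 5 * \<bar>\<Sum>v \<in> X. \<sigma> v :: int\<bar> \<le> 3 * int (card (boundary G X))"
  shows "has_nowhere_zero_flow 5 G"
proof -
  let ?V = "verts G"
  have deg: "\<And>v. v \<in> ?V \<Longrightarrow> degree G v = 3" using cubic by (simp add: regular_def)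
  \<comment> \<open>Both demands are odd, like the degree 3. Capacity 1 asks for a bound implied by
    \<open>bal\<close>; capacity 3 with demand \<open>- 5 * \<sigma> v\<close> asks for exactly
    \<open>bal\<close>.\<close>
  have "\<exists>p. odd_flow 1 G p \<and> (\<forall>v \<in> ?V. outflow G p v = \<sigma> v)"
    using sign deg bal by (intro odd_flow_with_demand[OF fin ll]) (simp_all, smt (verit))
  then obtain p where p: "odd_flow 1 G p" "\<And>v. v \<in> ?V \<Longrightarrow> outflow G p v = \<sigma> v" by blast
  have "\<exists>g. odd_flow 3 G g \<and> (\<forall>v \<in> ?V. outflow G g v = - 5 * \<sigma> v)"
    using sign deg bal
    by (intro odd_flow_with_demand[OF fin ll])
      (simp_all add: abs_mult sum_negf flip: sum_distrib_left)
  then obtain g where g: "odd_flow 3 G g" "\<And>v. v \<in> ?V \<Longrightarrow> outflow G g v = - 5 * \<sigma> v" by blast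
  define h where "h e v = (5 * p e v + g e v) div 2" for e v
  have h2: "2 * h e v = 5 * p e v + g e v" if "e \<in> edges G" "v \<in> ends G e" for e v
    using p(1) g(1) that unfolding odd_flow_def h_def by simp
  \<comment> \<open>With \<open>p e v\<close> equal to 1 or -1 and \<open>g e v\<close> among 1, -1,
    3, -3, the sum is 2, 4, 6 or 8 up to sign.\<close>
  have range: "h e v \<noteq> 0 \<and> \<bar>h e v\<bar> \<le> 4" if "e \<in> edges G" "v \<in> ends G e" for e v
  proof -
    have "odd (p e v)" "\<bar>p e v\<bar> \<le> 1" "odd (g e v)" "\<bar>g e v\<bar> \<le> 3"
      using p(1) g(1) that by (auto simp: odd_flow_def)
    moreover from this have "p e v = 1 \<or> p e v = -1" by presburger
    ultimately show ?thesis using h2[OF that] by presburger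
  qed
  \<comment> \<open>Each edge is directed away from its end with positive value.\<close>
  have "\<exists>t s. ends G e = {t, s} \<and> t \<noteq> s \<and> h e t > 0 \<and> h e s = - h e t" if e: "e \<in> edges G" for e
  proof -
    obtain x y where xy: "ends G e = {x, y}" "x \<noteq> y"
      using loopless_ends[OF ll e] .
    then have "p e x + p e y = 0" "g e x + g e y = 0"
      using p(1) g(1) e unfolding odd_flow_def by force+
    then have "h e x + h e y = 0" using h2[OF e, of x] h2[OF e, of y] xy by simp
    then show ?thesis
      using range[OF e, of x] range[OF e, of y] xy by (cases "h e x > 0") fastforce+
  qed
  then obtain t s where ts: "\<And>e. e \<in> edges G \<Longrightarrow>
      ends G e = {t e, s e} \<and> t e \<noteq> s e \<and> h e (t e) > 0 \<and> h e (s e) = - h e (t e)"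
    by metis
  define f where "f e = nat (h e (t e))" for e
  have f: "int (f e) = h e (t e)" if "e \<in> edges G" for e
    using ts[OF that] by (simp add: f_def)
  have "(\<Sum>e | e \<in> edges G \<and> s e = v. f e) = (\<Sum>e | e \<in> edges G \<and> t e = v. f e)" if v: "v \<in> ?V" for v
  proof -
    have finE: "finite (edges G)" using fin by (simp add: finite_graph_def)
    let ?T = "{e \<in> edges G. t e = v}" and ?S = "{e \<in> edges G. s e = v}"
    have un: "{e \<in> edges G. v \<in> ends G e} = ?T \<union> ?S" using ts by auto
    have "2 * (\<Sum>e \<in> ?T \<union> ?S. h e v) = (\<Sum>e \<in> ?T \<union> ?S. 5 * p e v + g e v)"
      unfolding sum_distrib_left using h2 un by (intro sum.cong) auto
    also have "\<dots> = 5 * outflow G p v + outflow G g v"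
      unfolding outflow_def un[symmetric] by (simp add: sum.distrib sum_distrib_left)
    also have "\<dots> = 0" using p(2) g(2) v by simp
    finally have "0 = (\<Sum>e \<in> ?T \<union> ?S. h e v)" by simp
    also have "\<dots> = (\<Sum>e \<in> ?T. h e v) + (\<Sum>e \<in> ?S. h e v)"
      using finE by (intro sum.union_disjoint) (simp_all, use ts in force)
    also have "(\<Sum>e \<in> ?T. h e v) = (\<Sum>e \<in> ?T. int (f e))"
      using f by (intro sum.cong) auto
    also have "(\<Sum>e \<in> ?S. h e v) = (\<Sum>e \<in> ?S. - int (f e))"
      using f ts by (intro sum.cong) auto
    finally have "int (sum f ?S) = int (sum f ?T)" by (simp add: sum_negf)
    then show ?thesis by (simp only: of_nat_eq_iff)
  qed
  moreover have "ends G e = {t e, s e} \<and> f e \<in> {1..5 - 1}" if "e \<in> edges G" for e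
    using ts[OF that] range[OF that, of "t e"] by (auto simp: f_def Suc_le_eq)
  ultimately show ?thesis unfolding has_nowhere_zero_flow_def by blast
qed

section \<open>Signs alternating along two matchings\<close>

definition edge_matching :: "('v, 'e) graph \<Rightarrow> 'e set \<Rightarrow> bool" where
  "edge_matching G N \<longleftrightarrow> N \<subseteq> edges G \<and> (\<forall>e \<in> N. \<forall>f \<in> N. e \<noteq> f \<longrightarrow> ends G e \<inter> ends G f = {})"

definition covered :: "('v, 'e) graph \<Rightarrow> 'e set \<Rightarrow> 'v set" where
  "covered G N = \<Union>(ends G ` N)"

text \<open>
  The graph formed by two matchings \<open>m\<close> and \<open>n\<close>, the first of them perfect, is bipartite. An edge
  \<open>uw\<close> of \<open>n\<close> is eliminated by deleting \<open>u\<close> and \<open>w\<close> and matching their \<open>m\<close>-partners to each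
  other, which preserves the parity of closed walks.
\<close>

lemma sign_of_two_involutions:
  fixes V :: "'v set"
  assumes "finite V"
    and "\<And>v. v \<in> V \<Longrightarrow> m v \<in> V \<and> m (m v) = v \<and> m v \<noteq> v"
    and "\<And>v. v \<in> V \<Longrightarrow> n v \<in> V \<and> n (n v) = v"
  shows "\<exists>\<sigma> :: 'v \<Rightarrow> int. \<forall>v \<in> V. \<bar>\<sigma> v\<bar> = 1 \<and> \<sigma> (m v) = - \<sigma> v \<and> (n v \<noteq> v \<longrightarrow> \<sigma> (n v) = - \<sigma> v)"
  using assms
proof (induction "card V" arbitrary: V m rule: less_induct)
  case less
  note m = less.prems(2) and n = less.prems(3)
  show ?case
  proof (cases "\<exists>u \<in> V. n u \<noteq> u")
    case False
    \<comment> \<open>The choice depends only on the pair \<open>{v, m v}\<close>, so both partners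
      agree on which of them gets the sign 1.\<close>
    define \<sigma> :: "'v \<Rightarrow> int" where "\<sigma> v = (if v = (SOME x. x \<in> {v, m v}) then 1 else - 1)" for v
    have "\<sigma> (m v) = - \<sigma> v" if "v \<in> V" for v
    proof -
      have "(SOME x. x \<in> {v, m v}) \<in> {v, m v}" by (metis insertI1 someI)
      then show ?thesis using m[OF that] by (auto simp: \<sigma>_def insert_commute)
    qed
    moreover have "\<bar>\<sigma> v\<bar> = 1" for v by (simp add: \<sigma>_def)
    ultimately show ?thesis using False by blast
  next
    case True
    then obtain u where u: "u \<in> V" "n u \<noteq> u" by blast
    define w where "w = n u"
    have w: "w \<in> V" "n w = u" "w \<noteq> u" using n[OF u(1)] u by (auto simp: w_def)
    let ?W = "V - {u, w}"
    have fin: "finite ?W" and lt: "card ?W < card V"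
      using less.prems(1) u by (auto intro: psubset_card_mono)
    have nW: "n v \<in> ?W \<and> n (n v) = v" if "v \<in> ?W" for v
      using n[of v] that w w_def by fastforce
    show ?thesis
    proof (cases "m u = w")
      case True
      then have mw: "m w = u" using m[OF u(1)] by simp
      have mW: "m v \<in> ?W \<and> m (m v) = v \<and> m v \<noteq> v" if "v \<in> ?W" for v
        using m[of v] that True mw by fastforce
      obtain \<tau> :: "'v \<Rightarrow> int" where \<tau>: "\<forall>v \<in> ?W. \<bar>\<tau> v\<bar> = 1 \<and> \<tau> (m v) = - \<tau> v \<and>
          (n v \<noteq> v \<longrightarrow> \<tau> (n v) = - \<tau> v)"
        using less.hyps[OF lt fin mW nW] by blast
      \<comment> \<open>The pair \<open>u\<close>, \<open>w\<close> is closed under both maps, so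
        its signs are independent of the rest.\<close>
      define \<sigma> where "\<sigma> = \<tau>(u := 1, w := - 1)"
      have "\<bar>\<sigma> v\<bar> = 1 \<and> \<sigma> (m v) = - \<sigma> v \<and> (n v \<noteq> v \<longrightarrow> \<sigma> (n v) = - \<sigma> v)" if vV: "v \<in> V" for v
      proof -
        consider "v = u" | "v = w" | "v \<in> ?W" using vV by blast
        then show ?thesis
        proof cases
          case 3
          then show ?thesis using \<tau> mW[OF 3] nW[OF 3] by (simp add: \<sigma>_def)
        qed (use True mw w w_def in \<open>simp_all add: \<sigma>_def\<close>)
      qed
      then show ?thesis by blast
    next
      case False
      define u' w' where "u' = m u" and "w' = m w"
      have u': "u' \<in> ?W" "m u' = u" and w': "w' \<in> ?W" "m w' = w" and "u' \<noteq> w'"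
        using m[OF u(1)] m[OF w(1)] False w(3) unfolding u'_def w'_def by force+
      define m' where "m' = m(u' := w', w' := u')"
      have mW: "m' v \<in> ?W \<and> m' (m' v) = v \<and> m' v \<noteq> v" if v: "v \<in> ?W" for v
      proof (cases "v = u' \<or> v = w'")
        case True
        then show ?thesis using u' w' \<open>u' \<noteq> w'\<close> by (auto simp: m'_def)
      next
        case v': False
        have mv: "m v \<in> V" "m (m v) = v" "m v \<noteq> v" using m v by blast+
        have "m v \<noteq> u" "m v \<noteq> w" "m v \<noteq> u'" "m v \<noteq> w'"
          using mv(2) v v' u'(2) w'(2) u'_def w'_def by force+
        then show ?thesis using mv v' by (simp add: m'_def)
      qed
      obtain \<tau> :: "'v \<Rightarrow> int" where \<tau>: "\<forall>v \<in> ?W. \<bar>\<tau> v\<bar> = 1 \<and> \<tau> (m' v) = - \<tau> v \<and>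
          (n v \<noteq> v \<longrightarrow> \<tau> (n v) = - \<tau> v)"
        using less.hyps[OF lt fin mW nW] by blast
      have \<tau>': "\<tau> w' = - \<tau> u'" "\<bar>\<tau> u'\<bar> = 1"
        using \<tau> u'(1) \<open>u' \<noteq> w'\<close> by (force simp: m'_def)+
      \<comment> \<open>The signs of \<open>u\<close> and \<open>w\<close> are forced by their
        \<open>m\<close>-partners. They come out opposite because \<open>m'\<close> makes
        \<open>\<tau>\<close> opposite on \<open>u'\<close> and \<open>w'\<close>.\<close>
      define \<sigma> where "\<sigma> = \<tau>(u := - \<tau> u', w := - \<tau> w')"
      have "\<bar>\<sigma> v\<bar> = 1 \<and> \<sigma> (m v) = - \<sigma> v \<and> (n v \<noteq> v \<longrightarrow> \<sigma> (n v) = - \<sigma> v)" if vV: "v \<in> V" for v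
      proof -
        consider "v = u" | "v = w" | "v \<in> ?W" using vV by blast
        then show ?thesis
        proof cases
          case 1
          then show ?thesis using u' w w_def \<tau>' by (simp add: \<sigma>_def flip: u'_def)
        next
          case 2
          then show ?thesis using w' w \<tau>' by (simp add: \<sigma>_def flip: w'_def)
        next
          case 3
          have n3: "\<bar>\<sigma> v\<bar> = 1 \<and> (n v \<noteq> v \<longrightarrow> \<sigma> (n v) = - \<sigma> v)"
            using \<tau> 3 nW[OF 3] by (simp add: \<sigma>_def)
          have "\<sigma> (m v) = - \<sigma> v"
          proof (cases "v = u' \<or> v = w'")
            case True
            then show ?thesis using u' w' w(3) by (auto simp: \<sigma>_def)
          next
            case v': False
            then have "m' v = m v" by (simp add: m'_def)
            moreover have "\<tau> (m' v) = - \<tau> v" using \<tau> 3 by blast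
            ultimately show ?thesis using 3 mW[OF 3] by (simp add: \<sigma>_def)
          qed
          then show ?thesis using n3 by blast
        qed
      qed
      then show ?thesis by blast
    qed
  qed
qed

text \<open>Passes to the partner map. Uncovered vertices become its fixed points, so a perfect
  matching yields an involution without fixed points.\<close>

lemma edge_matching_involution:
  assumes fin: "finite_graph G" and ll: "loopless G" and N: "edge_matching G N"
  shows "\<exists>n. (\<forall>v \<in> verts G. n v \<in> verts G \<and> n (n v) = v \<and> (n v = v \<longleftrightarrow> v \<notin> covered G N)) \<and>
    (\<forall>e \<in> N. \<forall>a b. ends G e = {a, b} \<and> a \<noteq> b \<longrightarrow> n a = b)"
proof -
  define n where "n v = (if v \<in> covered G N then SOME w. w \<noteq> v \<and> (\<exists>e \<in> N. ends G e = {v, w}) else v)" for v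
  have NE: "N \<subseteq> edges G" using N by (simp add: edge_matching_def)
  have partner: "n a = b" if e: "e \<in> N" "ends G e = {a, b}" "a \<noteq> b" for e a b
  proof -
    have "a \<in> covered G N" using e by (auto simp: covered_def)
    moreover have "(SOME w. w \<noteq> a \<and> (\<exists>e \<in> N. ends G e = {a, w})) = b"
    proof (rule some_equality)
      show "b \<noteq> a \<and> (\<exists>e \<in> N. ends G e = {a, b})" using e by blast
      fix w assume "w \<noteq> a \<and> (\<exists>e \<in> N. ends G e = {a, w})"
      then obtain f where f: "f \<in> N" "ends G f = {a, w}" by blast
      then have "f = e" using N e unfolding edge_matching_def by blast
      then show "w = b" using f e by (simp add: doubleton_eq_iff)
    qed
    ultimately show ?thesis by (simp add: n_def)
  qed
  have "n v \<in> verts G \<and> n (n v) = v \<and> (n v = v \<longleftrightarrow> v \<notin> covered G N)" if v: "v \<in> verts G" for v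
  proof (cases "v \<in> covered G N")
    case False
    then show ?thesis using v by (simp add: n_def)
  next
    case True
    then obtain e where e: "e \<in> N" "v \<in> ends G e" by (auto simp: covered_def)
    have eE: "e \<in> edges G" using e NE by blast
    obtain a b where ab: "ends G e = {a, b}" "a \<noteq> b" by (rule loopless_ends[OF ll eE])
    then obtain w where w: "ends G e = {v, w}" "v \<noteq> w" using e(2) by fastforce
    have "n v = w" using partner[OF e(1) w] .
    moreover have "n w = v" using partner[OF e(1), of w v] w by (simp add: insert_commute)
    moreover have "w \<in> verts G" using fin eE w by (auto simp: finite_graph_def)
    ultimately show ?thesis using True w by simp
  qed
  then show ?thesis using partner by blast
qed

lemma sign_of_two_matchings:
  assumes fin: "finite_graph G" and ll: "loopless G"
    and M: "edge_matching G M" and cov: "verts G \<subseteq> covered G M" and N: "edge_matching G N"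
  shows "\<exists>\<sigma> :: 'v \<Rightarrow> int. (\<forall>v \<in> verts G. \<bar>\<sigma> v\<bar> = 1) \<and> (\<forall>e \<in> M \<union> N. sum \<sigma> (ends (G :: ('v, 'e) graph) e) = 0)"
proof -
  obtain m where m: "\<And>v. v \<in> verts G \<Longrightarrow> m v \<in> verts G \<and> m (m v) = v \<and> (m v = v \<longleftrightarrow> v \<notin> covered G M)"
    "\<And>e a b. e \<in> M \<Longrightarrow> ends G e = {a, b} \<Longrightarrow> a \<noteq> b \<Longrightarrow> m a = b"
    using edge_matching_involution[OF fin ll M] by blast
  obtain n where n: "\<And>v. v \<in> verts G \<Longrightarrow> n v \<in> verts G \<and> n (n v) = v \<and> (n v = v \<longleftrightarrow> v \<notin> covered G N)"
    "\<And>e a b. e \<in> N \<Longrightarrow> ends G e = {a, b} \<Longrightarrow> a \<noteq> b \<Longrightarrow> n a = b"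
    using edge_matching_involution[OF fin ll N] by blast
  have "\<exists>\<sigma> :: 'v \<Rightarrow> int. \<forall>v \<in> verts G. \<bar>\<sigma> v\<bar> = 1 \<and> \<sigma> (m v) = - \<sigma> v \<and>
      (n v \<noteq> v \<longrightarrow> \<sigma> (n v) = - \<sigma> v)"
  proof (rule sign_of_two_involutions)
    show "finite (verts G)" using fin by (simp add: finite_graph_def)
    fix v assume v: "v \<in> verts G"
    show "m v \<in> verts G \<and> m (m v) = v \<and> m v \<noteq> v" using m(1)[OF v] cov v by blast
    show "n v \<in> verts G \<and> n (n v) = v" using n(1)[OF v] by blast
  qed
  then obtain \<sigma> :: "'v \<Rightarrow> int" where \<sigma>: "\<And>v. v \<in> verts G \<Longrightarrow> \<bar>\<sigma> v\<bar> = 1"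
    "\<And>v. v \<in> verts G \<Longrightarrow> \<sigma> (m v) = - \<sigma> v" "\<And>v. v \<in> verts G \<Longrightarrow> n v \<noteq> v \<Longrightarrow> \<sigma> (n v) = - \<sigma> v"
    by blast
  have "sum \<sigma> (ends G e) = 0" if e: "e \<in> M \<union> N" for e
  proof -
    have eE: "e \<in> edges G" using e M N by (auto simp: edge_matching_def)
    obtain a b where ab: "ends G e = {a, b}" "a \<noteq> b" by (rule loopless_ends[OF ll eE])
    have aV: "a \<in> verts G" using ab fin eE by (auto simp: finite_graph_def)
    have "\<sigma> b = - \<sigma> a"
    proof (cases "e \<in> M")
      case True
      then show ?thesis using m(2)[OF True ab] \<sigma>(2)[OF aV] by simp
    next
      case False
      then have "n a = b" using n(2) ab e by blast
      then show ?thesis using \<sigma>(3)[OF aV] ab by simp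
    qed
    then show ?thesis using ab by simp
  qed
  then show ?thesis using \<sigma>(1) by blast
qed

text \<open>An edge of \<open>N\<close> with both ends in \<open>X\<close> contributes 0 to the sum,
  and one with a single end in \<open>X\<close> contributes a sign.\<close>

lemma matching_imbalance:
  fixes G :: "('v, 'e) graph" and \<sigma> :: "'v \<Rightarrow> int"
  assumes fin: "finite_graph G" and N: "edge_matching G N"
    and \<sigma>: "\<And>v. v \<in> verts G \<Longrightarrow> \<bar>\<sigma> v\<bar> = 1" "\<And>e. e \<in> N \<Longrightarrow> sum \<sigma> (ends G e) = 0"
    and X: "X \<subseteq> verts G"
  shows "\<bar>sum \<sigma> (X \<inter> covered G N)\<bar> \<le> int (card (N \<inter> boundary G X))"
proof -
  have NE: "N \<subseteq> edges G" using N by (simp add: edge_matching_def)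
  have finN: "finite N" using NE fin finite_subset by (auto simp: finite_graph_def)
  have ends: "ends G e \<subseteq> verts G" if "e \<in> N" for e using fin NE that by (auto simp: finite_graph_def)
  have finX: "finite X" using X fin finite_subset by (auto simp: finite_graph_def)
  have disj: "\<forall>e \<in> N. \<forall>f \<in> N. e \<noteq> f \<longrightarrow> (X \<inter> ends G e) \<inter> (X \<inter> ends G f) = {}"
    using N unfolding edge_matching_def by blast
  have "X \<inter> covered G N = (\<Union>e \<in> N. X \<inter> ends G e)" by (auto simp: covered_def)
  then have "sum \<sigma> (X \<inter> covered G N) = (\<Sum>e \<in> N. sum \<sigma> (X \<inter> ends G e))"
    using sum.UNION_disjoint[OF finN _ disj] finX by simp
  also have "\<bar>\<dots>\<bar> \<le> (\<Sum>e \<in> N. \<bar>sum \<sigma> (X \<inter> ends G e)\<bar>)" by (rule sum_abs)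
  also have "\<dots> \<le> (\<Sum>e \<in> N. of_bool (e \<in> boundary G X))"
  proof (rule sum_mono)
    fix e assume e: "e \<in> N"
    show "\<bar>sum \<sigma> (X \<inter> ends G e)\<bar> \<le> of_bool (e \<in> boundary G X)"
    proof (cases "e \<in> boundary G X")
      case True
      then obtain x y where xy: "x \<in> ends G e" "x \<in> X" "y \<in> ends G e" "y \<notin> X"
        unfolding boundary_def by blast
      then have "ends G e = {x, y}" using finite_graph_ends[OF fin, of e x y] e NE by blast
      then have "X \<inter> ends G e = {x}" using xy by blast
      then show ?thesis using True \<sigma>(1)[of x] xy X by auto
    next
      case False
      then have "X \<inter> ends G e = {} \<or> X \<inter> ends G e = ends G e"
        using e NE ends[OF e] by (auto simp: boundary_def)
      then show ?thesis using \<sigma>(2)[OF e] False by auto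
    qed
  qed
  also have "\<dots> = int (card (N \<inter> boundary G X))"
    using finN by (simp add: Int_def)
  finally show ?thesis .
qed

text \<open>
  The circuit structure of a 2-regular graph is not needed: in the formula of Tutte and Berge every
  odd set is joined by at least two edges to the barrier \<open>U\<close>, unless \<open>U\<close> is empty.
\<close>

lemma circuit_near_perfect_matching:
  assumes fin: "finite_graph H" and ll: "loopless H" and reg: "regular 2 H"
    and K: "K \<in> verts H // connectedness H"
  shows "\<exists>N. edge_matching H N \<and> covered H N \<subseteq> K \<and> card (K - covered H N) \<le> of_bool (odd (card K))"
proof -
  let ?E = "ends H ` edges H"
  have KV: "K \<subseteq> verts H" using in_quotient_imp_subset[OF equiv_connectedness K] .
  have finK: "finite K" using KV fin finite_subset by (auto simp: finite_graph_def)
  obtain M U \<K> where M: "max_matching ?E K M" and U: "U \<subseteq> K" and disj: "disjoint \<K>"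
    and \<K>: "\<forall>L \<in> \<K>. L \<subseteq> K - U \<and> odd (card L) \<and>
      (\<forall>A \<in> ?E. card A = 2 \<and> A \<subseteq> K \<and> A \<inter> L \<noteq> {} \<longrightarrow> A \<subseteq> L \<union> U)"
    and card: "card \<K> = card U + card (K - \<Union>M)"
    using tutte_berge[OF finK] by meson
  have inK: "ends H e \<subseteq> K" if "e \<in> edges H" "ends H e \<inter> K \<noteq> {}" for e
    using component_boundary_empty[OF fin K] that fin unfolding boundary_def finite_graph_def by blast
  have closed: "ends H e \<subseteq> L \<union> U" if L: "L \<in> \<K>" and e: "e \<in> edges H" "ends H e \<inter> L \<noteq> {}" for L e
  proof -
    have "ends H e \<subseteq> K" using inK[OF e(1)] e(2) \<K> L by blast
    then show ?thesis using \<K> L e ll unfolding loopless_def by blast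
  qed
  have whole: "L = K" if L: "L \<in> \<K>" and b: "boundary H L = {}" for L
  proof (rule component_minimal[OF fin K])
    show "L \<subseteq> K" "L \<noteq> {}" using \<K> L by auto
  qed (rule b)
  have "card (K - \<Union>M) \<le> 1"
  proof (cases "U = {}")
    case True
    \<comment> \<open>With an empty barrier no edge leaves \<open>L\<close>, so connectedness leaves
      \<open>K\<close> as the only possible member of \<open>\<K>\<close>.\<close>
    have "L = K" if L: "L \<in> \<K>" for L
      using whole[OF L] closed[OF L] True unfolding boundary_def by blast
    then have "card \<K> \<le> card {K}" by (intro card_mono) auto
    then show ?thesis using card by simp
  next
    case False
    have "card \<K> \<le> card U"
    proof (rule card_family_le[OF fin reg _ _ disj])
      show "U \<subseteq> verts H" using U KV by blast
      fix L assume L: "L \<in> \<K>"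
      show LV: "L \<subseteq> verts H - U" using \<K> L KV by blast
      show "ends H e \<subseteq> L \<union> U" if "e \<in> boundary H L" for e
        using closed[OF L] that by (auto simp: boundary_def)
      \<comment> \<open>As \<open>L\<close> is a proper part of the connected set \<open>K\<close>,
        its cut is nonempty; 2-regularity makes it even, hence at least 2.\<close>
      have "L \<noteq> K" using \<K> L U False by blast
      then have "card (boundary H L) \<noteq> 0" using whole[OF L] finite_boundary[OF fin] by auto
      moreover have "L \<subseteq> verts H" using LV by blast
      then have "2 * card L = 2 * card {e \<in> edges H. ends H e \<subseteq> L} + card (boundary H L)"
        by (rule regular_sum_degree[OF fin reg])
      ultimately show "2 \<le> card (boundary H L)" by presburger
    qed simp
    then show ?thesis using card by simp
  qed
  \<comment> \<open>A matching covers an even number of vertices, so a deficiency of at most 1 is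
    determined by the parity of \<open>card K\<close>.\<close>
  moreover have Mm: "matching ?E K M" using M by (simp add: max_matching_def)
  then have "card (K - \<Union>M) + 2 * card M = card K" by (rule card_uncovered[OF finK])
  then have "odd (card K) \<longleftrightarrow> odd (card (K - \<Union>M))" by presburger
  ultimately have small: "card (K - \<Union>M) \<le> of_bool (odd (card K))"
    by (cases "card (K - \<Union>M) = 0") auto
  obtain N where N: "N \<subseteq> edges H" "inj_on (ends H) N" "ends H ` N = M"
    using matching_edges[OF Mm] by blast
  have "ends H e \<inter> ends H f = {}" if "e \<in> N" "f \<in> N" "e \<noteq> f" for e f
  proof (rule matching_disjoint[OF Mm])
    show "ends H e \<in> M" "ends H f \<in> M" using N(3) that by blast+
    show "ends H e \<noteq> ends H f" using N(2) that by (meson inj_onD)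
  qed
  then have "edge_matching H N" using N(1) by (simp add: edge_matching_def)
  moreover have "covered H N = \<Union>M" using N(3) by (simp add: covered_def)
  moreover have "\<Union>M \<subseteq> K" using Mm by (simp add: matching_def)
  ultimately show ?thesis using small by metis
qed

section \<open>Odd circuits\<close>

text \<open>Circuits are handled through their vertex sets; \<open>odd_circuits_eq\<close> returns
  to the component subgraphs.\<close>

abbreviation circuits :: "('v, 'e) graph \<Rightarrow> 'e set \<Rightarrow> 'v set set" where
  "circuits G F \<equiv> verts G // connectedness (spanning_subgraph G F)"

lemma one_factor_edge_matching:
  assumes fin: "finite_graph G" and ll: "loopless G" and M: "is_factor 1 G M"
  shows "edge_matching G M" "verts G \<subseteq> covered G M"
proof -
  have ME: "M \<subseteq> edges G" using M by (simp add: is_factor_def)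
  have one: "card {e \<in> M. v \<in> ends G e} = 1" if "v \<in> verts G" for v
    using M that loopless_degree[OF loopless_spanning_subgraph[OF ll ME]]
    by (simp add: is_factor_def regular_def)
  show "verts G \<subseteq> covered G M"
  proof
    fix v assume "v \<in> verts G"
    then have "{e \<in> M. v \<in> ends G e} \<noteq> {}" using one by (metis card.empty zero_neq_one)
    then show "v \<in> covered G M" by (auto simp: covered_def)
  qed
  have "e = f" if ef: "e \<in> M" "f \<in> M" and v: "v \<in> ends G e" "v \<in> ends G f" for e f v
  proof -
    have "v \<in> verts G" using fin ME ef v unfolding finite_graph_def by blast
    then obtain g where "{e \<in> M. v \<in> ends G e} = {g}" using one by (meson card_1_singletonE)
    moreover have "e \<in> {e \<in> M. v \<in> ends G e}" "f \<in> {e \<in> M. v \<in> ends G e}" using ef v by auto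
    ultimately show ?thesis by (metis singletonD)
  qed
  then show "edge_matching G M" using ME unfolding edge_matching_def by blast
qed

section \<open>Complementary factors and the parity of circuits\<close>

lemma factor_complement:
  assumes fin: "finite_graph G" and ll: "loopless G" and reg: "regular r G"
    and F: "is_factor k G F"
  shows "is_factor (r - k) G (edges G - F)"
proof -
  have FE: "F \<subseteq> edges G" using F by (simp add: is_factor_def)
  have "card {e \<in> edges G - F. v \<in> ends G e} = r - k" if v: "v \<in> verts G" for v
  proof -
    have "card {e \<in> edges G. v \<in> ends G e} = r" "card {e \<in> F. v \<in> ends G e} = k"
      using reg F v loopless_degree[OF ll] loopless_degree[OF loopless_spanning_subgraph[OF ll FE]]
      by (simp_all add: is_factor_def regular_def)
    moreover have "{e \<in> edges G - F. v \<in> ends G e} = {e \<in> edges G. v \<in> ends G e} - {e \<in> F. v \<in> ends G e}"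
      by blast
    moreover have "finite {e \<in> F. v \<in> ends G e}"
      using finite_subset[OF FE] fin by (simp add: finite_graph_def)
    moreover have "{e \<in> F. v \<in> ends G e} \<subseteq> {e \<in> edges G. v \<in> ends G e}" using FE by blast
    ultimately show ?thesis by (simp add: card_Diff_subset)
  qed
  then show ?thesis
    using loopless_degree[OF loopless_spanning_subgraph[OF ll, of "edges G - F"]]
    by (simp add: is_factor_def regular_def)
qed

lemma two_factor_exists:
  assumes "finite_graph G" "cubic G" "bridgeless G"
  shows "\<exists>F. is_factor 2 G F"
proof -
  obtain M where "is_factor 1 G M" using petersen[OF assms] by blast
  then have "is_factor (3 - 1) G (edges G - M)"
    using factor_complement[OF assms(1) bridgeless_cubic_loopless[OF assms] assms(2)] by blast
  then show ?thesis by auto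
qed

text \<open>A component of a 2-regular graph has as many edges as vertices, since its boundary is
  empty; so the parity can be read off the vertex set.\<close>

lemma odd_circuits_eq:
  assumes fin: "finite_graph G" and F: "is_factor 2 G F"
  shows "odd_circuits G F = induced_subgraph (spanning_subgraph G F) ` {K \<in> circuits G F. odd (card K)}"
proof -
  let ?H = "spanning_subgraph G F"
  have FE: "F \<subseteq> edges G" and reg: "regular 2 ?H" using F by (auto simp: is_factor_def)
  have finH: "finite_graph ?H" using finite_graph_spanning_subgraph[OF fin FE] .
  have "card (edges (induced_subgraph ?H K)) = card K" if K: "K \<in> circuits G F" for K
  proof -
    have KH: "K \<in> verts ?H // connectedness ?H" using K by simp
    have "K \<subseteq> verts ?H" using in_quotient_imp_subset[OF equiv_connectedness KH] .
    then have "2 * card K = 2 * card {e \<in> edges ?H. ends ?H e \<subseteq> K} + card (boundary ?H K)"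
      by (rule regular_sum_degree[OF finH reg])
    then show ?thesis
      using component_boundary_empty[OF finH KH] by (simp add: induced_subgraph_def)
  qed
  then show ?thesis unfolding odd_circuits_def components_def by auto
qed

lemma card_odd_circuits:
  assumes "finite_graph G" "is_factor 2 G F"
  shows "card (odd_circuits G F) = card {K \<in> circuits G F. odd (card K)}"
proof -
  have "inj_on (induced_subgraph (spanning_subgraph G F)) {K \<in> circuits G F. odd (card K)}"
    by (rule inj_on_inverseI[where g = verts]) (simp add: induced_subgraph_def)
  then show ?thesis by (simp add: odd_circuits_eq[OF assms] card_image)
qed

text \<open>
  Inside an odd circuit of the complement of \<open>M\<^sub>1\<close> the edges of \<open>M\<^sub>2\<close> cannot cover all
  vertices, so an edge of \<open>M\<^sub>1 \<inter> M\<^sub>2\<close> leaves it.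
\<close>

lemma card_odd_circuits_complement_le:
  assumes fin: "finite_graph G" and ll: "loopless G" and cubic: "cubic G"
    and M1: "is_factor 1 G M1" and M2: "is_factor 1 G M2"
  shows "card (odd_circuits G (edges G - M1)) \<le> 2 * card (M1 \<inter> M2)"
proof -
  let ?F = "edges G - M1"
  let ?H = "spanning_subgraph G ?F"
  let ?O = "{K \<in> circuits G ?F. odd (card K)}"
  have F: "is_factor 2 G ?F" using factor_complement[OF fin ll cubic M1] by simp
  have finH: "finite_graph ?H" using finite_graph_spanning_subgraph[OF fin] by blast
  have eqv: "equiv (verts G) (connectedness ?H)" using equiv_connectedness[of ?H] by simp
  have M2E: "M2 \<subseteq> edges G" and reg2: "regular 1 (spanning_subgraph G M2)"
    using M2 by (auto simp: is_factor_def)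
  have fin12: "finite (M1 \<inter> M2)" using M2E fin finite_subset by (auto simp: finite_graph_def)
  have "\<exists>v. v \<in> K \<and> v \<in> covered G (M1 \<inter> M2)" if K: "K \<in> circuits G ?F" "odd (card K)" for K
  proof -
    have KV: "K \<subseteq> verts G" using in_quotient_imp_subset[OF eqv K(1)] .
    have "card K = 2 * card {e \<in> M2. ends G e \<subseteq> K} + card (boundary G K \<inter> M2)"
      using regular_sum_degree[OF finite_graph_spanning_subgraph[OF fin M2E] reg2, of K] KV
      by (simp add: boundary_spanning_subgraph[OF M2E])
    then have "card (boundary G K \<inter> M2) \<noteq> 0" using K(2) by (metis add_0_right dvd_triv_left)
    then have "boundary G K \<inter> M2 \<noteq> {}" by (metis card.empty)
    then obtain e where e: "e \<in> boundary G K" "e \<in> M2" by blast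
    \<comment> \<open>Edges outside \<open>M1\<close> stay within the circuit, so the edge of
      \<open>M2\<close> leaving it is in \<open>M1\<close> too.\<close>
    have "boundary G K \<inter> ?F = {}"
      using component_boundary_empty[OF finH] K(1) boundary_spanning_subgraph[of ?F G K] by simp
    then have "e \<in> M1" using e M2E by blast
    then show ?thesis using e by (auto simp: covered_def boundary_def)
  qed
  then obtain v where v: "\<And>K. K \<in> ?O \<Longrightarrow> v K \<in> K \<and> v K \<in> covered G (M1 \<inter> M2)"
    by (metis (no_types, lifting) mem_Collect_eq)
  \<comment> \<open>Distinct circuits are disjoint and so choose distinct ends of common edges. The
    factor 2 counts the two ends of each such edge.\<close>
  have "inj_on v ?O"
  proof (rule inj_onI)
    fix K L assume K: "K \<in> ?O" and L: "L \<in> ?O" and eq: "v K = v L"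
    have "v K \<in> K \<inter> L" using v[OF K] v[OF L] eq by simp
    then show "K = L" using quotient_disj[OF eqv, of K L] K L by blast
  qed
  moreover have "v ` ?O \<subseteq> covered G (M1 \<inter> M2)" using v by blast
  moreover have "finite (covered G (M1 \<inter> M2))"
    unfolding covered_def using fin12 M2E fin by (auto simp: finite_graph_def intro: finite_subset)
  ultimately have "card ?O \<le> card (covered G (M1 \<inter> M2))" by (rule card_inj_on_le)
  also have "\<dots> \<le> (\<Sum>e \<in> M1 \<inter> M2. card (ends G e))"
    unfolding covered_def by (rule card_UN_le[OF fin12])
  also have "\<dots> = 2 * card (M1 \<inter> M2)"
    using ll M2E by (subst sum.cong[OF refl, of _ _ "\<lambda>_. 2"]) (auto simp: loopless_def)
  finally show ?thesis using card_odd_circuits[OF fin F] by simp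
qed

text \<open>The edges of a circuit inside \<open>X\<close> survive the deletion of the boundary, so
  the circuit stays within one component. The vertex \<open>a\<close> marks the side on which this
  component lies.\<close>

lemma subgraph_of_separated_component:
  assumes fin: "finite_graph G" and F: "is_factor 2 G F"
    and K: "K \<in> circuits G F" "odd (card K)" and X: "K \<subseteq> X"
  shows "\<exists>C \<in> components (delete_edges G (boundary G X)). \<exists>a \<in> K. a \<in> verts C \<and>
    (\<exists>D \<in> odd_circuits G F. subgraph D C)"
proof -
  let ?H = "spanning_subgraph G F" and ?D = "delete_edges G (boundary G X)"
  have FE: "F \<subseteq> edges G" using F by (simp add: is_factor_def)
  have finH: "finite_graph ?H" using finite_graph_spanning_subgraph[OF fin FE] .
  have finD: "finite_graph ?D" using fin by (auto simp: finite_graph_def)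
  have KH: "K \<in> verts ?H // connectedness ?H" using K(1) by simp
  have KV: "K \<subseteq> verts G" using in_quotient_imp_subset[OF equiv_connectedness KH] by simp
  obtain a where a: "a \<in> K" using K(2) by fastforce
  define P where "P = connectedness ?D `` {a}"
  have PQ: "P \<in> verts ?D // connectedness ?D" using a KV by (auto simp: P_def intro: quotientI)
  have aP: "a \<in> P" using a KV by (auto simp: P_def connectedness_def)
  have inK: "ends G e \<subseteq> K" if "e \<in> F" "ends G e \<inter> K \<noteq> {}" for e
  proof -
    have "ends G e \<subseteq> verts G" using fin FE that(1) by (auto simp: finite_graph_def)
    moreover have "e \<notin> boundary ?H K" using component_boundary_empty[OF finH KH] by blast
    ultimately show ?thesis using that by (auto simp: boundary_def)
  qed
  have FD: "e \<in> edges ?D" if "e \<in> F" "ends G e \<subseteq> K" for e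
    using that X FE by (auto simp: boundary_def)
  \<comment> \<open>An edge of \<open>F\<close> meeting \<open>P \<inter> K\<close> stays in
    \<open>K\<close>, survives the deletion and hence stays in \<open>P\<close>; minimality of the
    circuit does the rest.\<close>
  have "P \<inter> K = K"
  proof (rule component_minimal[OF finH KH])
    show "P \<inter> K \<noteq> {}" using a aP by blast
    have "e \<notin> boundary ?H (P \<inter> K)" for e
    proof
      assume e: "e \<in> boundary ?H (P \<inter> K)"
      then have eF: "e \<in> F" and meet: "ends G e \<inter> (P \<inter> K) \<noteq> {}" and out: "\<not> ends G e \<subseteq> P \<inter> K"
        by (auto simp: boundary_def)
      have eK: "ends G e \<subseteq> K" using inK[OF eF] meet by blast
      have "e \<notin> boundary ?D P" using component_boundary_empty[OF finD PQ] by blast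
      then have "ends G e \<subseteq> P"
        using FD[OF eF eK] meet KV eK by (auto simp: boundary_def)
      then show False using eK out by blast
    qed
    then show "boundary ?H (P \<inter> K) = {}" by blast
  qed simp
  then have KP: "K \<subseteq> P" by blast
  have "subgraph (induced_subgraph ?H K) (induced_subgraph ?D P)"
    using KP FD by (auto simp: subgraph_def induced_subgraph_def)
  moreover have "induced_subgraph ?D P \<in> components ?D" using PQ by (simp add: components_def)
  moreover have "induced_subgraph ?H K \<in> odd_circuits G F"
    using K by (simp add: odd_circuits_eq[OF fin F])
  ultimately show ?thesis using a aP
    by (intro bexI[of _ "induced_subgraph ?D P"] bexI[of _ a] conjI bexI[of _ "induced_subgraph ?H K"])
      (simp_all add: induced_subgraph_def)
qed

lemma boundary_separates_odd_circuits:
  assumes fin: "finite_graph G" and F: "is_factor 2 G F" and X: "X \<subseteq> verts G"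
    and K: "K \<in> circuits G F" "odd (card K)" "K \<subseteq> X"
    and L: "L \<in> circuits G F" "odd (card L)" "L \<inter> X = {}"
  shows "edge_cut G (boundary G X)" "separates_odd_circuits G F (boundary G X)"
proof -
  let ?D = "delete_edges G (boundary G X)"
  have eqv: "equiv (verts G) (connectedness (spanning_subgraph G F))"
    using equiv_connectedness[of "spanning_subgraph G F"] by simp
  have finD: "finite_graph ?D" using fin by (auto simp: finite_graph_def)
  have ne: "K \<noteq> {}" "L \<noteq> {}" and LV: "L \<subseteq> verts G - X"
    using K L in_quotient_imp_subset[OF eqv L(1)] by auto
  then have "X \<noteq> {}" "X \<subset> verts G" using K(3) X by blast+
  then show "edge_cut G (boundary G X)" by (auto simp: edge_cut_def boundary_def)
  obtain C a where C: "C \<in> components ?D" "a \<in> K" "a \<in> verts C" "\<exists>D \<in> odd_circuits G F. subgraph D C"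
    using subgraph_of_separated_component[OF fin F K] by blast
  obtain C' b where C': "C' \<in> components ?D" "b \<in> L" "b \<in> verts C'" "\<exists>D \<in> odd_circuits G F. subgraph D C'"
    using subgraph_of_separated_component[OF fin F L(1,2) LV] boundary_complement[OF X] by auto
  \<comment> \<open>A common component would contain a path from \<open>K\<close> to
    \<open>L\<close> avoiding the boundary of \<open>X\<close>.\<close>
  have "C \<noteq> C'"
  proof
    assume "C = C'"
    then obtain P where P: "P \<in> verts ?D // connectedness ?D" "a \<in> P" "b \<in> P"
      using C C' by (auto simp: components_def induced_subgraph_def)
    then have "(a, b) \<in> connectedness ?D"
      using in_quotient_imp_in_rel[OF equiv_connectedness P(1)] by blast
    then have "(a, b) \<in> (adjacency ?D)\<^sup>*" by (simp add: connectedness_def)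
    moreover have "boundary ?D X = {}" by (auto simp: boundary_def)
    ultimately have "b \<in> X" using reachable_boundary_empty[OF finD] C(2) K(3) by blast
    then show False using C'(2) L(3) by blast
  qed
  then show "separates_odd_circuits G F (boundary G X)"
    unfolding separates_odd_circuits_def using C C' by blast
qed

text \<open>The separating cut bounds the set under \<open>Max\<close>, so the maximum is attained
  and obeys the same bound.\<close>

lemma m_factor_le_card_boundary:
  assumes "finite_graph G" "is_factor 2 G F" "X \<subseteq> verts G"
    and "K \<in> circuits G F" "odd (card K)" "K \<subseteq> X"
    and "L \<in> circuits G F" "odd (card L)" "L \<inter> X = {}"
  shows "m_factor G F \<le> card (boundary G X)"
proof -
  let ?S = "{k. \<not> (\<exists>X. edge_cut G X \<and> card X < k \<and> separates_odd_circuits G F X)}"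
  have le: "k \<le> card (boundary G X)" if "k \<in> ?S" for k
    using that boundary_separates_odd_circuits[OF assms] by force
  then have "finite ?S" by (meson finite_nat_set_iff_bounded_le)
  moreover have "0 \<in> ?S" by simp
  then have "?S \<noteq> {}" by (simp only: ex_in_conv[symmetric]) (rule exI)
  ultimately have "Max ?S \<in> ?S" by (rule Max_in)
  then show ?thesis unfolding m_factor_def by (rule le)
qed

section \<open>Balanced valuations\<close>

text \<open>Here \<open>k\<close> takes the part of \<open>mu2 G\<close>. The assumption
  \<open>far\<close> is the lower bound on separating cuts in subtraction-free form, and
  \<open>few\<close> bounds the number of vertices that the matching inside \<open>F\<close>
  misses.\<close>

lemma five_flow_from_two_factor:
  fixes G :: "('v, 'e) graph"
  assumes fin: "finite_graph G" and ll: "loopless G" and cubic: "cubic G"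
    and F: "is_factor 2 G F" and few: "card {K \<in> circuits G F. odd (card K)} \<le> 2 * k"
    and far: "\<And>X K L. \<lbrakk>X \<subseteq> verts G; K \<in> circuits G F; odd (card K); K \<subseteq> X;
      L \<in> circuits G F; odd (card L); L \<inter> X = {}\<rbrakk> \<Longrightarrow> 5 * k \<le> card (boundary G X) + 3"
  shows "has_nowhere_zero_flow 5 G"
proof -
  let ?V = "verts G" and ?H = "spanning_subgraph G F" and ?M = "edges G - F"
  let ?Q = "circuits G F"
  have FE: "F \<subseteq> edges G" and reg: "regular 2 ?H" using F by (auto simp: is_factor_def)
  have finV: "finite ?V" and finE: "finite (edges G)" using fin by (auto simp: finite_graph_def)
  have finH: "finite_graph ?H" and llH: "loopless ?H"
    using finite_graph_spanning_subgraph[OF fin FE] loopless_spanning_subgraph[OF ll FE] .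
  have eqv: "equiv ?V (connectedness ?H)" using equiv_connectedness[of ?H] by simp
  have finQ: "finite ?Q" using finite_components[OF finH] by simp
  have UQ: "\<Union>?Q = ?V" using Union_quotient[OF eqv] .
  have QV: "K \<subseteq> ?V" if "K \<in> ?Q" for K using UQ that by blast
  have disjQ: "K \<inter> L = {}" if "K \<in> ?Q" "L \<in> ?Q" "K \<noteq> L" for K L
    using quotient_disj[OF eqv that(1,2)] that(3) by blast
  have M: "is_factor 1 G ?M" using factor_complement[OF fin ll cubic F] by simp
  have Mm: "edge_matching G ?M" and Mcov: "?V \<subseteq> covered G ?M"
    using one_factor_edge_matching[OF fin ll M] by blast+
  have "\<forall>K \<in> ?Q. \<exists>N. edge_matching ?H N \<and> covered ?H N \<subseteq> K \<and>
      card (K - covered ?H N) \<le> of_bool (odd (card K))"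
    using circuit_near_perfect_matching[OF finH llH reg] by simp
  then obtain N where "\<And>K. K \<in> ?Q \<Longrightarrow> edge_matching ?H (N K) \<and> covered ?H (N K) \<subseteq> K \<and>
      card (K - covered ?H (N K)) \<le> of_bool (odd (card K))"
    by (meson bchoice)
  then have NH: "edge_matching ?H (N K)" and Ncov: "covered G (N K) \<subseteq> K"
    and Nmiss: "card (K - covered G (N K)) \<le> of_bool (odd (card K))" if "K \<in> ?Q" for K
    using that by (auto simp: covered_def)
  have NF: "N K \<subseteq> F" if "K \<in> ?Q" for K using NH[OF that] by (simp add: edge_matching_def)
  \<comment> \<open>The matchings of the single circuits combine into one matching inside
    \<open>F\<close>, leaving at most one vertex uncovered per odd circuit.\<close>
  define A where "A = (\<Union>K \<in> ?Q. N K)"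
  have AF: "A \<subseteq> F" using NF by (auto simp: A_def)
  have Am: "edge_matching G A"
    unfolding edge_matching_def
  proof (intro conjI ballI impI)
    show "A \<subseteq> edges G" using AF FE by blast
    fix e f assume "e \<in> A" "f \<in> A" and ef: "e \<noteq> f"
    then obtain K L where K: "K \<in> ?Q" "e \<in> N K" and L: "L \<in> ?Q" "f \<in> N L" by (auto simp: A_def)
    show "ends G e \<inter> ends G f = {}"
    proof (cases "K = L")
      case True
      then show ?thesis using NH[OF K(1)] K L ef by (simp add: edge_matching_def)
    next
      case False
      have "ends G e \<subseteq> K" "ends G f \<subseteq> L" using Ncov K L by (auto simp: covered_def)
      then show ?thesis using disjQ[OF K(1) L(1) False] by blast
    qed
  qed
  obtain \<sigma> :: "'v \<Rightarrow> int" where \<sigma>: "\<And>v. v \<in> ?V \<Longrightarrow> \<bar>\<sigma> v\<bar> = 1"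
    and \<sigma>M: "\<And>e. e \<in> ?M \<Longrightarrow> sum \<sigma> (ends G e) = 0" and \<sigma>A: "\<And>e. e \<in> A \<Longrightarrow> sum \<sigma> (ends G e) = 0"
    using sign_of_two_matchings[OF fin ll Mm Mcov Am] by blast
  define S where "S X = sum \<sigma> X" for X
  have odd\<sigma>: "odd (\<sigma> v)" if "v \<in> ?V" for v using \<sigma>[OF that] by presburger
  have S_le_card: "\<bar>S X\<bar> \<le> int (card X)" if "X \<subseteq> ?V" for X
  proof -
    have "\<bar>S X\<bar> \<le> (\<Sum>v \<in> X. \<bar>\<sigma> v\<bar>)" unfolding S_def by (rule sum_abs)
    also have "\<dots> = (\<Sum>v \<in> X. 1)" using \<sigma> that by (intro sum.cong) auto
    finally show ?thesis by simp
  qed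
  have S_M: "\<bar>S X\<bar> \<le> int (card (?M \<inter> boundary G X))" if "X \<subseteq> ?V" for X
    using matching_imbalance[OF fin Mm \<sigma> \<sigma>M that] Mcov that by (simp add: S_def Int_absorb2)
  have S_split: "S X = S (X \<inter> Y) + S (X - Y)" if "X \<subseteq> ?V" for X Y
    unfolding S_def using finite_subset[OF that finV] by (simp add: sum.Int_Diff)
  have SV: "S ?V = 0" using S_M[of ?V] by (simp add: boundary_def)
  have cut_split: "card (boundary G X) = card (?M \<inter> boundary G X) + card (boundary ?H X)" for X
  proof -
    have "boundary G X = (?M \<inter> boundary G X) \<union> boundary ?H X"
      using boundary_spanning_subgraph[OF FE, of X] by (auto simp: boundary_def)
    moreover have "(?M \<inter> boundary G X) \<inter> boundary ?H X = {}" by (auto simp: boundary_def)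
    ultimately show ?thesis
      using finite_boundary[OF fin, of X] by (metis card_Un_disjoint finite_Un)
  qed
  have even_cut: "even (card (boundary ?H X))" if "X \<subseteq> ?V" for X
  proof -
    have "X \<subseteq> verts ?H" using that by simp
    then have "2 * card X = 2 * card {e \<in> edges ?H. ends ?H e \<subseteq> X} + card (boundary ?H X)"
      by (rule regular_sum_degree[OF finH reg])
    then show ?thesis by presburger
  qed

  have no_odd: "5 * \<bar>S X\<bar> \<le> 3 * int (card (boundary G X))"
    if X: "X \<subseteq> ?V" and no: "\<And>K. K \<in> ?Q \<Longrightarrow> odd (card K) \<Longrightarrow> \<not> K \<subseteq> X" for X
  proof -
    \<comment> \<open>The covered part of the circuit contributes at most its number d of cut edges,
      the uncovered vertex at most 1. If d is positive, it is even, so 1 is at most d/2 and the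
      total at most 3d/2.\<close>
    have circuit: "2 * \<bar>S (X \<inter> K)\<bar> \<le> 3 * int (card (boundary ?H (X \<inter> K)))" if K: "K \<in> ?Q" for K
    proof -
      let ?R = "X \<inter> (K - covered G (N K))"
      have finK: "finite K" using finite_subset[OF QV[OF K] finV] .
      have cov: "\<bar>S (X \<inter> K \<inter> covered G (N K))\<bar> \<le> int (card (boundary ?H (X \<inter> K)))"
      proof -
        have "\<bar>sum \<sigma> (X \<inter> K \<inter> covered ?H (N K))\<bar> \<le> int (card (N K \<inter> boundary ?H (X \<inter> K)))"
          using \<sigma> \<sigma>A K X by (intro matching_imbalance[OF finH NH[OF K]]) (auto simp: A_def)
        also have "\<dots> \<le> int (card (boundary ?H (X \<inter> K)))"
          using finite_boundary[OF finH] by (simp add: card_mono)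
        finally show ?thesis by (simp add: S_def covered_def)
      qed
      have split: "S (X \<inter> K) = S (X \<inter> K \<inter> covered G (N K)) + S ?R"
        using S_split[of "X \<inter> K" "covered G (N K)"] X by (auto simp: Int_Diff)
      have "card ?R \<le> card (K - covered G (N K))" using finK by (intro card_mono) auto
      then have R: "card ?R \<le> of_bool (odd (card K))" using Nmiss[OF K] by linarith
      have SR: "\<bar>S ?R\<bar> \<le> int (card ?R)" using X by (intro S_le_card) auto
      show ?thesis
      proof (cases "boundary ?H (X \<inter> K) = {}")
        case True
        \<comment> \<open>An uncut circuit lies outside \<open>X\<close> or inside it; in the latter
          case it is even by \<open>no\<close> and has no uncovered vertex.\<close>
        have "S ?R = 0"
        proof (cases "X \<inter> K = {}")
          case True
          then have "?R = {}" by blast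
          then show ?thesis by (simp add: S_def)
        next
          case False
          then have "X \<inter> K = K"
            using component_minimal[OF finH _ _ False True] K by simp
          then have "even (card K)" using no[OF K] by blast
          then show ?thesis using R SR by simp
        qed
        then show ?thesis using cov split True by simp
      next
        case False
        then have "card (boundary ?H (X \<inter> K)) \<noteq> 0" using finite_boundary[OF finH] by simp
        moreover have "even (card (boundary ?H (X \<inter> K)))" using even_cut X by blast
        ultimately have "2 \<le> card (boundary ?H (X \<inter> K))" by presburger
        moreover have "\<bar>S ?R\<bar> \<le> 1" using SR R by (cases "odd (card K)") auto
        ultimately show ?thesis using cov split by linarith
      qed
    qed
    have "S X = (\<Sum>K \<in> ?Q. S (X \<inter> K))"
    proof -
      have "X = (\<Union>K \<in> ?Q. X \<inter> K)" using UQ X by blast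
      moreover have "sum \<sigma> (\<Union>K \<in> ?Q. X \<inter> K) = (\<Sum>K \<in> ?Q. S (X \<inter> K))"
        unfolding S_def using finQ finite_subset[OF X finV] disjQ
        by (intro sum.UNION_disjoint) (simp_all, blast)
      ultimately show ?thesis by (simp add: S_def)
    qed
    then have "2 * \<bar>S X\<bar> \<le> (\<Sum>K \<in> ?Q. 2 * \<bar>S (X \<inter> K)\<bar>)"
      by (simp add: sum_abs flip: sum_distrib_left)
    also have "\<dots> \<le> (\<Sum>K \<in> ?Q. 3 * int (card (boundary ?H (X \<inter> K))))"
      by (rule sum_mono) (rule circuit)
    also have "\<dots> = 3 * int (\<Sum>K \<in> ?Q. card (boundary ?H (X \<inter> K)))"
      by (simp add: sum_distrib_left)
    also have "(\<Sum>K \<in> ?Q. card (boundary ?H (X \<inter> K))) \<le> card (boundary ?H X)"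
    proof -
      have inK: "ends G e \<subseteq> K" if K: "K \<in> ?Q" and e: "e \<in> boundary ?H (X \<inter> K)" for K e
      proof -
        have "e \<notin> boundary ?H K" using component_boundary_empty[OF finH] K by simp
        moreover have "ends G e \<subseteq> ?V" using e fin FE by (auto simp: boundary_def finite_graph_def)
        ultimately show ?thesis using e by (auto simp: boundary_def)
      qed
      have "boundary ?H (X \<inter> K) \<inter> boundary ?H (X \<inter> L) = {}"
        if K: "K \<in> ?Q" and L: "L \<in> ?Q" and "K \<noteq> L" for K L
      proof (rule ccontr)
        assume "\<not> ?thesis"
        then obtain e where e: "e \<in> boundary ?H (X \<inter> K)" "e \<in> boundary ?H (X \<inter> L)" by blast
        then have "ends G e \<subseteq> K \<inter> L" using inK[OF K] inK[OF L] by blast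
        then have "ends G e = {}" using disjQ[OF that] by blast
        then show False using e by (simp add: boundary_def)
      qed
      then have "(\<Sum>K \<in> ?Q. card (boundary ?H (X \<inter> K))) = card (\<Union>K \<in> ?Q. boundary ?H (X \<inter> K))"
        using finQ finite_boundary[OF finH] by (subst card_UN_disjoint) auto
      also have "\<dots> \<le> card (boundary ?H X)"
      proof (rule card_mono[OF finite_boundary[OF finH]], rule UN_least)
        fix K assume K: "K \<in> ?Q"
        show "boundary ?H (X \<inter> K) \<subseteq> boundary ?H X"
        proof
          fix e assume e: "e \<in> boundary ?H (X \<inter> K)"
          then show "e \<in> boundary ?H X" using inK[OF K e] by (auto simp: boundary_def)
        qed
      qed
      finally show ?thesis .
    qed
    finally have "2 * \<bar>S X\<bar> \<le> 3 * int (card (boundary ?H X))" by simp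
    \<comment> \<open>Three times the bound through \<open>?M\<close> is added to the bound just
      found, since the two cut parts add up to the whole.\<close>
    then show ?thesis using S_M[OF X] cut_split[of X] by linarith
  qed

  have bal: "5 * \<bar>S X\<bar> \<le> 3 * int (card (boundary G X))" if X: "X \<subseteq> ?V" for X
  proof -
    consider "\<forall>K \<in> ?Q. odd (card K) \<longrightarrow> \<not> K \<subseteq> X" | "\<forall>K \<in> ?Q. odd (card K) \<longrightarrow> \<not> K \<subseteq> ?V - X"
      | K L where "K \<in> ?Q" "odd (card K)" "K \<subseteq> X" "L \<in> ?Q" "odd (card L)" "L \<subseteq> ?V - X"
      by blast
    then show ?thesis
    proof cases
      case 1
      then show ?thesis using no_odd[OF X] by blast
    next
      case 2
      then have "5 * \<bar>S (?V - X)\<bar> \<le> 3 * int (card (boundary G (?V - X)))"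
        using no_odd[of "?V - X"] by blast
      \<comment> \<open>The total sign is 0 because nothing leaves the whole vertex set, so passing
        to the complement preserves both sides of the claim.\<close>
      moreover have "S X + S (?V - X) = 0" using S_split[of ?V X] SV X by (simp add: Int_absorb1)
      ultimately show ?thesis using boundary_complement[OF X] by (metis abs_minus_cancel add_eq_0_iff)
    next
      case 3
      then have large: "5 * k \<le> card (boundary G X) + 3" using far[OF X] by blast
      define R where "R = ?V - covered G A"
      have cov: "\<bar>S (X \<inter> covered G A)\<bar> \<le> int (card (boundary ?H X))" if "X \<subseteq> ?V" for X
      proof -
        have "\<bar>S (X \<inter> covered G A)\<bar> \<le> int (card (A \<inter> boundary G X))"
          unfolding S_def by (rule matching_imbalance[OF fin Am \<sigma> \<sigma>A that])
        also have "\<dots> \<le> int (card (boundary ?H X))"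
          using AF finite_boundary[OF finH, of X] boundary_spanning_subgraph[OF FE, of X]
          by (auto intro: card_mono)
        finally show ?thesis .
      qed
      have "S (?V \<inter> covered G A) = 0" using cov[of ?V] by (simp add: boundary_def)
      then have SR0: "S R = 0" using S_split[of ?V "covered G A"] SV by (simp add: R_def)
      have "card R \<le> (\<Sum>K \<in> ?Q. card (K - covered G (N K)))"
      proof -
        have "covered G (N K) \<subseteq> covered G A" if "K \<in> ?Q" for K
          using that by (auto simp: covered_def A_def)
        then have "v \<in> (\<Union>K \<in> ?Q. K - covered G (N K))" if "v \<in> \<Union>?Q" "v \<notin> covered G A" for v
          using that by (auto elim!: UnionE)
        then have "R \<subseteq> (\<Union>K \<in> ?Q. K - covered G (N K))" unfolding UQ R_def by (meson DiffE subsetI)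
        moreover have "finite (\<Union>K \<in> ?Q. K - covered G (N K))"
          by (rule finite_UN_I[OF finQ]) (rule finite_Diff[OF finite_subset[OF QV finV]])
        ultimately have "card R \<le> card (\<Union>K \<in> ?Q. K - covered G (N K))" by (rule card_mono[rotated])
        also have "\<dots> \<le> (\<Sum>K \<in> ?Q. card (K - covered G (N K)))" by (rule card_UN_le[OF finQ])
        finally show ?thesis .
      qed
      also have "\<dots> \<le> (\<Sum>K \<in> ?Q. of_bool (odd (card K)))" by (rule sum_mono) (rule Nmiss)
      also have "\<dots> = card {K \<in> ?Q. odd (card K)}" using finQ by (simp add: Int_def)
      finally have cardR: "card R \<le> 2 * k" using few by linarith
      have RV: "R \<subseteq> ?V" by (auto simp: R_def)
      have finR: "finite R" using finite_subset[OF RV finV] .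
      \<comment> \<open>The signs on \<open>R\<close> cancel, so both parts of \<open>R\<close> have
        the same absolute sum. The smaller part has at most \<open>k\<close> vertices, which halves
        the bound \<open>2 * k\<close>.\<close>
      have "\<bar>S (R \<inter> X)\<bar> \<le> int (card (R \<inter> X))" "\<bar>S (R - X)\<bar> \<le> int (card (R - X))"
        using RV by (auto intro!: S_le_card)
      moreover have "S (R \<inter> X) + S (R - X) = 0" using S_split[OF RV, of X] SR0 by simp
      moreover have "card (R \<inter> X) + card (R - X) = card R"
        using finR by (metis card_Int_Diff)
      ultimately have SRX: "\<bar>S (R \<inter> X)\<bar> \<le> int k" using cardR by linarith
      have "X - covered G A = R \<inter> X" using X by (auto simp: R_def)
      then have "S X = S (X \<inter> covered G A) + S (R \<inter> X)" using S_split[OF X, of "covered G A"] by simp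
      \<comment> \<open>One copy of the sum is bounded through \<open>A\<close> and
        \<open>R\<close>, the other through \<open>?M\<close>; the two cut parts again add
        up.\<close>
      then have sum2: "2 * \<bar>S X\<bar> \<le> int (card (boundary G X)) + int k"
        using cov[OF X] SRX S_M[OF X] cut_split[of X] by linarith
      have "even (S X) \<longleftrightarrow> even (card {v \<in> X. odd (\<sigma> v)})"
        unfolding S_def using finite_subset[OF X finV] by (rule even_sum_iff)
      also have "{v \<in> X. odd (\<sigma> v)} = X" using odd\<sigma> X by blast
      finally have "even (S X) \<longleftrightarrow> even (card X)" .
      moreover have "3 * card X = 2 * card {e \<in> edges G. ends G e \<subseteq> X} + card (boundary G X)"
        by (rule regular_sum_degree[OF fin cubic X])
      ultimately have par: "even (S X) \<longleftrightarrow> even (card (boundary G X))" by presburger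
      show ?thesis
      proof (rule ccontr)
        assume "\<not> ?thesis"
        \<comment> \<open>With d the size of the cut, \<open>sum2\<close> and \<open>large\<close>
          give 10 |S X| <= 6 d + 3, so 5 |S X| <= 3 d + 1. The one remaining value has the wrong
          parity.\<close>
        then have "5 * \<bar>S X\<bar> = 3 * int (card (boundary G X)) + 1" using sum2 large by linarith
        then show False using par by presburger
      qed
    qed
  qed
  show ?thesis
    using five_flow_from_balanced_valuation[OF fin cubic ll odd\<sigma> bal[unfolded S_def]] .
qed

theorem theorem2p3:
  fixes G :: "('v, 'e) graph"
  assumes "finite_graph G" and "cubic G" and "bridgeless G"
    and "ereal_of_enat (m_star G) \<ge> 5 * ereal (real (mu2 G)) - 3"
  shows "has_nowhere_zero_flow 5 G"
proof -
  note fin = assms(1)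
  have ll: "loopless G" using bridgeless_cubic_loopless assms by blast
  have finE: "finite (edges G)" using fin by (simp add: finite_graph_def)
  have finP: "finite (Pow (edges G))" using finE by simp
  let ?I = "{card (M1 \<inter> M2) | M1 M2. is_factor 1 G M1 \<and> is_factor 1 G M2}"
  let ?W = "{card (odd_circuits G F) | F. is_factor 2 G F}"
  have "mu2 G \<in> ?I"
    unfolding mu2_def
  proof (rule Min_in)
    have "?I \<subseteq> (\<lambda>(M1, M2). card (M1 \<inter> M2)) ` (Pow (edges G) \<times> Pow (edges G))"
      by (auto simp: is_factor_def)
    then show "finite ?I" using finP by (meson finite_SigmaI finite_imageI finite_subset)
    show "?I \<noteq> {}" using petersen[OF assms(1-3)] by blast
  qed
  then obtain M1 M2 where M12: "is_factor 1 G M1" "is_factor 1 G M2" "mu2 G = card (M1 \<inter> M2)"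
    by blast
  have "?W \<subseteq> (\<lambda>F. card (odd_circuits G F)) ` Pow (edges G)" by (auto simp: is_factor_def)
  then have finW: "finite ?W" using finP by (meson finite_imageI finite_subset)
  \<comment> \<open>The complement of one member of an optimal pair already has at most
    \<open>2 * mu2 G\<close> odd circuits, which bounds the oddness.\<close>
  have "is_factor 2 G (edges G - M1)" using factor_complement[OF fin ll assms(2) M12(1)] by simp
  then have "card (odd_circuits G (edges G - M1)) \<in> ?W" by blast
  then have "oddness G \<le> card (odd_circuits G (edges G - M1))"
    unfolding oddness_def using finW by (intro Min_le)
  then have odd_le: "oddness G \<le> 2 * mu2 G"
    using card_odd_circuits_complement_le[OF fin ll assms(2) M12(1,2)] M12(3) by simp
  have "oddness G \<in> ?W"
    unfolding oddness_def using two_factor_exists[OF assms(1-3)] by (intro Min_in[OF finW]) blast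
  then obtain F0 where F0: "min_two_factor G F0" by (auto simp: min_two_factor_def)
  \<comment> \<open>If the oddness is 0, a minimum 2-factor has no odd circuit and the assumption
    \<open>far\<close> holds vacuously; hence the guard on the bound for
    \<open>m_factor\<close>.\<close>
  have flow: ?thesis if F: "min_two_factor G F"
    and m: "oddness G \<noteq> 0 \<Longrightarrow> 5 * mu2 G \<le> m_factor G F + 3" for F
  proof -
    have F2: "is_factor 2 G F" and card: "card {K \<in> circuits G F. odd (card K)} = oddness G"
      using F card_odd_circuits[OF fin, of F] by (auto simp: min_two_factor_def)
    show ?thesis
    proof (rule five_flow_from_two_factor[OF fin ll assms(2) F2])
      show "card {K \<in> circuits G F. odd (card K)} \<le> 2 * mu2 G" using card odd_le by simp
      fix X K L assume X: "X \<subseteq> verts G" and K: "K \<in> circuits G F" "odd (card K)" "K \<subseteq> X"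
        and L: "L \<in> circuits G F" "odd (card L)" "L \<inter> X = {}"
      have "finite {K \<in> circuits G F. odd (card K)}"
        using finite_components[OF finite_graph_spanning_subgraph[OF fin, of F]] F2
        by (simp add: is_factor_def)
      then have "oddness G \<noteq> 0" using K card by (metis (mono_tags, lifting) card_0_eq empty_iff mem_Collect_eq)
      then show "5 * mu2 G \<le> card (boundary G X) + 3"
        using m m_factor_le_card_boundary[OF fin F2 X K L] by linarith
    qed
  qed
  show ?thesis
  proof (cases "oddness G = 0")
    case True
    then show ?thesis using flow[OF F0] by simp
  next
    case False
    let ?Z = "{m_factor G F | F. min_two_factor G F}"
    have "?Z \<subseteq> m_factor G ` Pow (edges G)" by (auto simp: min_two_factor_def is_factor_def)
    then have "finite ?Z" using finP by (meson finite_imageI finite_subset)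
    moreover have "?Z \<noteq> {}" using F0 by blast
    \<comment> \<open>Some minimum 2-factor attains \<open>m_star G\<close>, and this one is used
      for the flow.\<close>
    ultimately have "Max ?Z \<in> ?Z" by (rule Max_in)
    then obtain F where F: "min_two_factor G F" "Max ?Z = m_factor G F" by auto
    have "m_star G = enat (m_factor G F)" using False F(2) by (simp add: m_star_def)
    then have "5 * ereal (real (mu2 G)) - 3 \<le> ereal (real (m_factor G F))" using assms(4) by simp
    moreover have "5 * ereal (real (mu2 G)) - 3 = ereal (5 * real (mu2 G) - 3)"
      by (metis ereal_minus(1) numeral_eq_ereal times_ereal.simps(1))
    ultimately have "5 * real (mu2 G) - 3 \<le> real (m_factor G F)" by simp
    \<comment> \<open>The 3 changes sides because subtraction would be truncated on natural
      numbers.\<close>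
    then have "5 * mu2 G \<le> m_factor G F + 3" by linarith
    then show ?thesis using flow[OF F(1)] by simp
  qed
qed

end
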